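(* Let $G$ be a unique product monoid, $S=R*G$ a crossed product, and $I$ a proper ideal of $R$. Suppose $I$ is $G$-invariant and suppose that either (a) $R$ is commutative and $(G,\sigma)$ is reversible up to conjugation, or (b) $\sigma$ is pointwise surjective. Then $I$ is $S$-prime (i.e. $IS$ is a prime ideal of $S$) if and only if $AB\subseteq I$ implies $A\subseteq I$ or $B\subseteq I$ whenever $A,B$ are ideals of $R$ with $B$ $G$-stable.
   Context: Rings have $1$, ideals are two-sided. A unique product monoid is a monoid $G$ (identity $e$) such that whenever $X,Y$ are nonempty finite subsets of $G$, there exist $x\in X$, $y\in Y$ with $xy\ne x'y'$ for every pair $(x',y')\in X\times Y$ different from $(x,y)$. A crossed product $S=R*G$ is determined by a ring $R$, a monoid $G$, and functions $\sigma:G\to\operatorname{End}_{\mathrm{Ring}}(R)$ and $c:G\times G\to GL_1(R)$ (units of $R$); write $r^g=\sigma(g)(r)$ and $X^g=\{x^g:x\in X\}$ for $X\subseteq R$. $S=\bigoplus_{g\in G}R\overline{g}$ is a free left $R$-module with basis $\{\overline g:g\in G\}$ and multiplication determined by $\overline g\, r=r^g\,\overline g$ and $\overline g\,\overline h=c(g,h)\overline{gh}$, where for all $r\in R$, $g,h,i\in G$: $r^e=r$; $c(g,e)=c(e,g)=1$; $(r^h)^g c(g,h)=c(g,h)r^{gh}$; $c(g,h)c(gh,i)=c(h,i)^g c(g,hi)$. $R$ is identified with $R\overline e$. $\sigma$ is pointwise surjective if $\sigma(g)$ is surjective for all $g\in G$. For $g,h\in G$ write $g\equiv h$ if $\sigma(g)=\tau\circ\sigma(h)$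 for some inner automorphism $\tau$ of $R$. $(G,\sigma)$ is reversible up to conjugation if for any $g,h\in G$ there exist $h_1,h_2\in G$ with $gh\equiv h_1g$ and $hg\equiv gh_2$. An ideal $I$ of $R$ is $G$-stable if $I^g\subseteq I$ for all $g\in G$, and $G$-invariant if $\sigma(g)^{-1}(I)=I$ for all $g\in G$. Prime ideals are proper. *)

theory Defs
  imports "HOL-Algebra.Ring" "HOL-Algebra.Ideal" "HOL-Algebra.Ideal_Product"
begin

text \<open>The locale \<^locale>\<open>primeideal\<close> is restricted to commutative rings; this is primeness of a
  two-sided ideal in an arbitrary ring, in terms of products of two-sided ideals.\<close>

locale noncomm_primeideal = ideal P R for P and R (structure) +
  assumes P_notcarr: "P \<noteq> carrier R"
    and P_prime: "\<lbrakk>ideal A R; ideal B R; A \<cdot>\<^bsub>R\<^esub> B \<subseteq> P\<rbrakk> \<Longrightarrow> A \<subseteq> P \<or> B \<subseteq> P"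

locale unique_product_monoid = monoid G for G (structure) +
  assumes unique_product:
    "\<lbrakk>X \<subseteq> carrier G; Y \<subseteq> carrier G; finite X; finite Y; X \<noteq> {}; Y \<noteq> {}\<rbrakk> \<Longrightarrow>
      \<exists>x\<in>X. \<exists>y\<in>Y. \<forall>x'\<in>X. \<forall>y'\<in>Y. (x', y') \<noteq> (x, y) \<longrightarrow> x \<otimes> y \<noteq> x' \<otimes> y'"

text \<open>The values of \<open>\<sigma>\<close> and \<open>c\<close> outside of the carriers are irrelevant.\<close>

locale crossed_system = ring R + G: monoid G
  for R :: "('r, 'm) ring_scheme" (structure) and G :: "('g, 'n) monoid_scheme" (structure)
    and \<sigma> :: "'g \<Rightarrow> 'r \<Rightarrow> 'r" and c :: "'g \<Rightarrow> 'g \<Rightarrow> 'r" +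
  assumes sigma_hom: "g \<in> carrier G \<Longrightarrow> \<sigma> g \<in> ring_hom R R"
    and c_unit: "\<lbrakk>g \<in> carrier G; h \<in> carrier G\<rbrakk> \<Longrightarrow> c g h \<in> Units R"
    and sigma_one: "r \<in> carrier R \<Longrightarrow> \<sigma> \<one>\<^bsub>G\<^esub> r = r"
    and c_one_right: "g \<in> carrier G \<Longrightarrow> c g \<one>\<^bsub>G\<^esub> = \<one>\<^bsub>R\<^esub>"
    and c_one_left: "g \<in> carrier G \<Longrightarrow> c \<one>\<^bsub>G\<^esub> g = \<one>\<^bsub>R\<^esub>"
    and twist: "\<lbrakk>g \<in> carrier G; h \<in> carrier G; r \<in> carrier R\<rbrakk> \<Longrightarrow>
      \<sigma> g (\<sigma> h r) \<otimes>\<^bsub>R\<^esub> c g h = c g h \<otimes>\<^bsub>R\<^esub> \<sigma> (g \<otimes>\<^bsub>G\<^esub> h) r"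
    and cocycle: "\<lbrakk>g \<in> carrier G; h \<in> carrier G; i \<in> carrier G\<rbrakk> \<Longrightarrow>
      c g h \<otimes>\<^bsub>R\<^esub> c (g \<otimes>\<^bsub>G\<^esub> h) i = \<sigma> g (c h i) \<otimes>\<^bsub>R\<^esub> c g (h \<otimes>\<^bsub>G\<^esub> i)"

text \<open>An element \<open>\<Sum>\<^sub>g r\<^sub>g g\<close> of the crossed product is represented by its coefficient function
  \<open>g \<mapsto> r\<^sub>g\<close>, which has finite support contained in the carrier of \<open>G\<close>. The multiplication is the
  biadditive extension of \<open>(r x)(s y) = r s\<^sup>x c(x, y) (xy)\<close>.\<close>

definition crossed_product ::
  "('r, 'm) ring_scheme \<Rightarrow> ('g, 'n) monoid_scheme \<Rightarrow> ('g \<Rightarrow> 'r \<Rightarrow> 'r) \<Rightarrow> ('g \<Rightarrow> 'g \<Rightarrow> 'r)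
    \<Rightarrow> ('g \<Rightarrow> 'r) ring"
  where "crossed_product R G \<sigma> c =
    \<lparr>carrier = {f. f \<in> UNIV \<rightarrow> carrier R \<and> {g. f g \<noteq> \<zero>\<^bsub>R\<^esub>} \<subseteq> carrier G \<and> finite {g. f g \<noteq> \<zero>\<^bsub>R\<^esub>}},
     mult = (\<lambda>f h k. \<Oplus>\<^bsub>R\<^esub>p\<in>{(x, y). f x \<noteq> \<zero>\<^bsub>R\<^esub> \<and> h y \<noteq> \<zero>\<^bsub>R\<^esub> \<and> x \<otimes>\<^bsub>G\<^esub> y = k}.
       case p of (x, y) \<Rightarrow> f x \<otimes>\<^bsub>R\<^esub> \<sigma> x (h y) \<otimes>\<^bsub>R\<^esub> c x y),
     one = (\<lambda>g. if g = \<one>\<^bsub>G\<^esub> then \<one>\<^bsub>R\<^esub> else \<zero>\<^bsub>R\<^esub>),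
     zero = (\<lambda>g. \<zero>\<^bsub>R\<^esub>),
     add = (\<lambda>f h g. f g \<oplus>\<^bsub>R\<^esub> h g)\<rparr>"

text \<open>The element \<open>r g\<close>; the identification of \<open>R\<close> with a subring of the crossed product is
  \<open>r \<mapsto> crossed_monom R \<one>\<^bsub>G\<^esub> r\<close>.\<close>

definition crossed_monom :: "('r, 'm) ring_scheme \<Rightarrow> 'g \<Rightarrow> 'r \<Rightarrow> 'g \<Rightarrow> 'r"
  where "crossed_monom R g r = (\<lambda>x. if x = g then r else \<zero>\<^bsub>R\<^esub>)"

context crossed_system
begin

abbreviation CS where "CS \<equiv> crossed_product R G \<sigma> c"

lemma sigma_closed: "g \<in> carrier G \<Longrightarrow> r \<in> carrier R \<Longrightarrow> \<sigma> g r \<in> carrier R"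
  by (rule ring_hom_closed[OF sigma_hom])

lemma sigma_add: "g \<in> carrier G \<Longrightarrow> r \<in> carrier R \<Longrightarrow> s \<in> carrier R \<Longrightarrow>
    \<sigma> g (r \<oplus> s) = \<sigma> g r \<oplus> \<sigma> g s"
  by (rule ring_hom_add[OF sigma_hom])

lemma sigma_mult: "g \<in> carrier G \<Longrightarrow> r \<in> carrier R \<Longrightarrow> s \<in> carrier R \<Longrightarrow>
    \<sigma> g (r \<otimes> s) = \<sigma> g r \<otimes> \<sigma> g s"
  by (rule ring_hom_mult[OF sigma_hom])

lemma sigma_zero: "g \<in> carrier G \<Longrightarrow> \<sigma> g \<zero> = \<zero>"
  using ring_hom_zero[OF sigma_hom ring_axioms ring_axioms] .

lemma c_closed: "g \<in> carrier G \<Longrightarrow> h \<in> carrier G \<Longrightarrow> c g h \<in> carrier R"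
  using c_unit by blast

lemma CS_carrierD:
  assumes "f \<in> carrier CS"
  shows "f x \<in> carrier R" "f x \<noteq> \<zero> \<Longrightarrow> x \<in> carrier G" "finite {x. f x \<noteq> \<zero>}" "{x. f x \<noteq> \<zero>} \<subseteq> carrier G"
  using assms by (auto simp: crossed_product_def)

lemma CS_carrierI:
  assumes "\<And>x. f x \<in> carrier R" "finite A" "A \<subseteq> carrier G" "\<And>x. x \<notin> A \<Longrightarrow> f x = \<zero>"
  shows "f \<in> carrier CS"
proof -
  have "{x. f x \<noteq> \<zero>} \<subseteq> A" using assms(4) by auto
  thus ?thesis using assms by (auto simp: crossed_product_def intro: finite_subset)
qed

lemma CS_add: "f \<oplus>\<^bsub>CS\<^esub> h = (\<lambda>g. f g \<oplus> h g)"
  and CS_zero: "\<zero>\<^bsub>CS\<^esub> = (\<lambda>g. \<zero>)"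
  and CS_one: "\<one>\<^bsub>CS\<^esub> = crossed_monom R \<one>\<^bsub>G\<^esub> \<one>"
  by (simp_all add: crossed_product_def crossed_monom_def)

lemma CS_mult_expand:
  assumes f: "f \<in> carrier CS" and h: "h \<in> carrier CS"
    and A: "finite A" "A \<subseteq> carrier G" "{x. f x \<noteq> \<zero>} \<subseteq> A"
    and B: "finite B" "B \<subseteq> carrier G" "{x. h x \<noteq> \<zero>} \<subseteq> B"
  shows "(f \<otimes>\<^bsub>CS\<^esub> h) k = (\<Oplus>p\<in>A\<times>B. if fst p \<otimes>\<^bsub>G\<^esub> snd p = k
     then f (fst p) \<otimes> \<sigma> (fst p) (h (snd p)) \<otimes> c (fst p) (snd p) else \<zero>)"
proof -
  have "(f \<otimes>\<^bsub>CS\<^esub> h) k = (\<Oplus>p\<in>{(x, y). f x \<noteq> \<zero> \<and> h y \<noteq> \<zero> \<and> x \<otimes>\<^bsub>G\<^esub> y = k}.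
       case p of (x, y) \<Rightarrow> f x \<otimes> \<sigma> x (h y) \<otimes> c x y)"
    by (simp add: crossed_product_def)
  also have "\<dots> = (\<Oplus>p\<in>A\<times>B. if fst p \<otimes>\<^bsub>G\<^esub> snd p = k
     then f (fst p) \<otimes> \<sigma> (fst p) (h (snd p)) \<otimes> c (fst p) (snd p) else \<zero>)"
  proof (rule add.finprod_mono_neutral_cong_left)
    show "finite (A \<times> B)" using A B by simp
    show "{(x, y). f x \<noteq> \<zero> \<and> h y \<noteq> \<zero> \<and> x \<otimes>\<^bsub>G\<^esub> y = k} \<subseteq> A \<times> B" using A B by auto
    show "(\<lambda>p. if fst p \<otimes>\<^bsub>G\<^esub> snd p = k
     then f (fst p) \<otimes> \<sigma> (fst p) (h (snd p)) \<otimes> c (fst p) (snd p) else \<zero>) \<in> A \<times> B \<rightarrow> carrier R"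
      using A(2) B(2) CS_carrierD(1)[OF f] CS_carrierD(1)[OF h]
      by (auto intro!: m_closed sigma_closed c_closed)
    fix p assume p: "p \<in> A \<times> B - {(x, y). f x \<noteq> \<zero> \<and> h y \<noteq> \<zero> \<and> x \<otimes>\<^bsub>G\<^esub> y = k}"
    obtain x y where xy: "p = (x, y)" by fastforce
    have "x \<in> carrier G" "y \<in> carrier G" "f x = \<zero> \<or> h y = \<zero> \<or> x \<otimes>\<^bsub>G\<^esub> y \<noteq> k"
      using p xy A B by auto
    thus "(if fst p \<otimes>\<^bsub>G\<^esub> snd p = k
     then f (fst p) \<otimes> \<sigma> (fst p) (h (snd p)) \<otimes> c (fst p) (snd p) else \<zero>) = \<zero>"
      using xy CS_carrierD(1)[OF f] CS_carrierD(1)[OF h]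
      by (auto simp: sigma_zero sigma_closed c_closed)
  qed auto
  finally show ?thesis .
qed

lemma CS_mult_closed:
  assumes f: "f \<in> carrier CS" and h: "h \<in> carrier CS"
  shows "f \<otimes>\<^bsub>CS\<^esub> h \<in> carrier CS"
proof -
  let ?A = "{x. f x \<noteq> \<zero>}" and ?B = "{x. h x \<noteq> \<zero>}"
  have e: "(f \<otimes>\<^bsub>CS\<^esub> h) k = (\<Oplus>p\<in>?A\<times>?B. if fst p \<otimes>\<^bsub>G\<^esub> snd p = k
     then f (fst p) \<otimes> \<sigma> (fst p) (h (snd p)) \<otimes> c (fst p) (snd p) else \<zero>)" for k
    using CS_carrierD[OF f] CS_carrierD[OF h] by (intro CS_mult_expand[OF f h]) auto
  show ?thesis
  proof (rule CS_carrierI)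
    show "finite ((\<lambda>p. fst p \<otimes>\<^bsub>G\<^esub> snd p) ` (?A \<times> ?B))"
      using CS_carrierD[OF f] CS_carrierD[OF h] by simp
    show "(\<lambda>p. fst p \<otimes>\<^bsub>G\<^esub> snd p) ` (?A \<times> ?B) \<subseteq> carrier G"
      using CS_carrierD[OF f] CS_carrierD[OF h] by auto
    show "(f \<otimes>\<^bsub>CS\<^esub> h) k \<in> carrier R" for k
      unfolding e using CS_carrierD[OF f] CS_carrierD[OF h]
      by (intro finsum_closed) (auto intro!: m_closed sigma_closed c_closed)
    fix k assume "k \<notin> (\<lambda>p. fst p \<otimes>\<^bsub>G\<^esub> snd p) ` (?A \<times> ?B)"
    thus "(f \<otimes>\<^bsub>CS\<^esub> h) k = \<zero>" unfolding e by (intro add.finprod_one_eqI) auto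
  qed
qed

lemma crossed_monom_closed:
  "g \<in> carrier G \<Longrightarrow> r \<in> carrier R \<Longrightarrow> crossed_monom R g r \<in> carrier CS"
  by (rule CS_carrierI[of _ "{g}"]) (auto simp: crossed_monom_def)

lemma crossed_monom_mult:
  assumes "g \<in> carrier G" "h \<in> carrier G" "r \<in> carrier R" "s \<in> carrier R"
  shows "crossed_monom R g r \<otimes>\<^bsub>CS\<^esub> crossed_monom R h s =
    crossed_monom R (g \<otimes>\<^bsub>G\<^esub> h) (r \<otimes> \<sigma> g s \<otimes> c g h)"
proof
  fix k
  have "(crossed_monom R g r \<otimes>\<^bsub>CS\<^esub> crossed_monom R h s) k =
    (\<Oplus>p\<in>{g}\<times>{h}. if fst p \<otimes>\<^bsub>G\<^esub> snd p = k
     then crossed_monom R g r (fst p) \<otimes> \<sigma> (fst p) (crossed_monom R h s (snd p)) \<otimes> c (fst p) (snd p) else \<zero>)"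
    by (rule CS_mult_expand) (use assms in \<open>auto simp: crossed_monom_closed\<close>, auto simp: crossed_monom_def split: if_splits)
  also have "\<dots> = crossed_monom R (g \<otimes>\<^bsub>G\<^esub> h) (r \<otimes> \<sigma> g s \<otimes> c g h) k"
    using assms by (auto simp: crossed_monom_def finsum_insert sigma_closed c_closed)
  finally show "(crossed_monom R g r \<otimes>\<^bsub>CS\<^esub> crossed_monom R h s) k =
    crossed_monom R (g \<otimes>\<^bsub>G\<^esub> h) (r \<otimes> \<sigma> g s \<otimes> c g h) k" .
qed

lemma CS_abelian_group: "abelian_group CS"
proof (rule abelian_groupI)
  fix f h assume fh: "f \<in> carrier CS" "h \<in> carrier CS"
  note [simp] = CS_carrierD(1)[OF fh(1)] CS_carrierD(1)[OF fh(2)]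
  show "f \<oplus>\<^bsub>CS\<^esub> h \<in> carrier CS"
    by (rule CS_carrierI[of _ "{x. f x \<noteq> \<zero>} \<union> {x. h x \<noteq> \<zero>}"])
      (use CS_carrierD[OF fh(1)] CS_carrierD[OF fh(2)] in \<open>auto simp: CS_add\<close>)
  show "f \<oplus>\<^bsub>CS\<^esub> h = h \<oplus>\<^bsub>CS\<^esub> f" by (simp add: CS_add a_comm)
  fix i assume i: "i \<in> carrier CS"
  note [simp] = CS_carrierD(1)[OF i]
  show "f \<oplus>\<^bsub>CS\<^esub> h \<oplus>\<^bsub>CS\<^esub> i = f \<oplus>\<^bsub>CS\<^esub> (h \<oplus>\<^bsub>CS\<^esub> i)" by (simp add: CS_add a_assoc)
next
  show "\<zero>\<^bsub>CS\<^esub> \<in> carrier CS" by (rule CS_carrierI[of _ "{}"]) (auto simp: CS_zero)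
next
  fix f assume f: "f \<in> carrier CS"
  note [simp] = CS_carrierD(1)[OF f]
  show "\<zero>\<^bsub>CS\<^esub> \<oplus>\<^bsub>CS\<^esub> f = f" by (simp add: CS_add CS_zero)
  have "(\<lambda>x. \<ominus> f x) \<in> carrier CS"
    by (rule CS_carrierI[of _ "{x. f x \<noteq> \<zero>}"]) (use CS_carrierD[OF f] in auto)
  moreover have "(\<lambda>x. \<ominus> f x) \<oplus>\<^bsub>CS\<^esub> f = \<zero>\<^bsub>CS\<^esub>" by (simp add: CS_add CS_zero l_neg)
  ultimately show "\<exists>y\<in>carrier CS. y \<oplus>\<^bsub>CS\<^esub> f = \<zero>\<^bsub>CS\<^esub>" by blast
qed

lemma CS_distr:
  assumes f: "f \<in> carrier CS" and h: "h \<in> carrier CS" and i: "i \<in> carrier CS"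
  shows "(f \<oplus>\<^bsub>CS\<^esub> h) \<otimes>\<^bsub>CS\<^esub> i = f \<otimes>\<^bsub>CS\<^esub> i \<oplus>\<^bsub>CS\<^esub> h \<otimes>\<^bsub>CS\<^esub> i"
    and "i \<otimes>\<^bsub>CS\<^esub> (f \<oplus>\<^bsub>CS\<^esub> h) = i \<otimes>\<^bsub>CS\<^esub> f \<oplus>\<^bsub>CS\<^esub> i \<otimes>\<^bsub>CS\<^esub> h"
proof -
  define A where "A = {x. f x \<noteq> \<zero>} \<union> {x. h x \<noteq> \<zero>} \<union> {x. i x \<noteq> \<zero>}"
  note D = CS_carrierD[OF f] CS_carrierD[OF h] CS_carrierD[OF i]
  have A: "finite A" "A \<subseteq> carrier G" using D by (auto simp: A_def)
  interpret CS: abelian_group CS by (rule CS_abelian_group)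
  have fh: "f \<oplus>\<^bsub>CS\<^esub> h \<in> carrier CS" using f h by simp
  have s: "{x. f x \<noteq> \<zero>} \<subseteq> A" "{x. h x \<noteq> \<zero>} \<subseteq> A" "{x. i x \<noteq> \<zero>} \<subseteq> A"
    "{x. (f \<oplus>\<^bsub>CS\<^esub> h) x \<noteq> \<zero>} \<subseteq> A"
    using D by (auto simp: A_def CS_add)
  note E = CS_mult_expand[OF _ _ A _ A]
  show "(f \<oplus>\<^bsub>CS\<^esub> h) \<otimes>\<^bsub>CS\<^esub> i = f \<otimes>\<^bsub>CS\<^esub> i \<oplus>\<^bsub>CS\<^esub> h \<otimes>\<^bsub>CS\<^esub> i"
  proof
    fix k
    show "((f \<oplus>\<^bsub>CS\<^esub> h) \<otimes>\<^bsub>CS\<^esub> i) k = (f \<otimes>\<^bsub>CS\<^esub> i \<oplus>\<^bsub>CS\<^esub> h \<otimes>\<^bsub>CS\<^esub> i) k"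
      unfolding CS_add[of "f \<otimes>\<^bsub>CS\<^esub> i"] E[OF f i s(1,3)] E[OF h i s(2,3)] E[OF fh i s(4,3)]
      by (subst finsum_addf[symmetric])
        (use A D in \<open>auto intro!: finsum_cong' m_closed a_closed sigma_closed c_closed
           simp: CS_add l_distr sigma_closed c_closed subset_iff\<close>)
  qed
  show "i \<otimes>\<^bsub>CS\<^esub> (f \<oplus>\<^bsub>CS\<^esub> h) = i \<otimes>\<^bsub>CS\<^esub> f \<oplus>\<^bsub>CS\<^esub> i \<otimes>\<^bsub>CS\<^esub> h"
  proof
    fix k
    show "(i \<otimes>\<^bsub>CS\<^esub> (f \<oplus>\<^bsub>CS\<^esub> h)) k = (i \<otimes>\<^bsub>CS\<^esub> f \<oplus>\<^bsub>CS\<^esub> i \<otimes>\<^bsub>CS\<^esub> h) k"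
      unfolding CS_add[of "i \<otimes>\<^bsub>CS\<^esub> f"] E[OF i f s(3,1)] E[OF i h s(3,2)] E[OF i fh s(3,4)]
      by (subst finsum_addf[symmetric])
        (use A D in \<open>auto intro!: finsum_cong' m_closed a_closed sigma_closed c_closed
           simp: CS_add l_distr r_distr sigma_add sigma_closed c_closed subset_iff\<close>)
  qed
qed

lemma CS_induct [consumes 1, case_names zero add]:
  assumes f: "f \<in> carrier CS"
    and z: "P \<zero>\<^bsub>CS\<^esub>"
    and a: "\<And>g r h. g \<in> carrier G \<Longrightarrow> r \<in> carrier R \<Longrightarrow> h \<in> carrier CS \<Longrightarrow> P h \<Longrightarrow>
      P (crossed_monom R g r \<oplus>\<^bsub>CS\<^esub> h)"
  shows "P f"
proof -
  have "\<forall>f. f \<in> carrier CS \<longrightarrow> {x. f x \<noteq> \<zero>} \<subseteq> A \<longrightarrow> P f" if "finite A" for A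
    using that
  proof (induction A)
    case empty
    have "f = \<zero>\<^bsub>CS\<^esub>" if "{x. f x \<noteq> \<zero>} \<subseteq> {}" for f using that by (auto simp: CS_zero)
    thus ?case using z by auto
  next
    case (insert b A)
    show ?case
    proof (intro allI impI)
      fix f assume f: "f \<in> carrier CS" and s: "{x. f x \<noteq> \<zero>} \<subseteq> insert b A"
      show "P f"
      proof (cases "f b = \<zero>")
        case True
        hence "{x. f x \<noteq> \<zero>} \<subseteq> A" using s by auto
        thus ?thesis using insert.IH f by blast
      next
        case False
        let ?h = "f(b := \<zero>)"
        have h: "?h \<in> carrier CS"
          by (rule CS_carrierI[of _ "{x. f x \<noteq> \<zero>}"]) (use CS_carrierD[OF f] in auto)
        have "{x. ?h x \<noteq> \<zero>} \<subseteq> A" using s by auto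
        hence "P ?h" using insert.IH h by blast
        hence "P (crossed_monom R b (f b) \<oplus>\<^bsub>CS\<^esub> ?h)"
          using a[of b "f b" ?h] h CS_carrierD[OF f] False by blast
        moreover have "crossed_monom R b (f b) \<oplus>\<^bsub>CS\<^esub> ?h = f"
          using CS_carrierD[OF f] by (auto simp: CS_add crossed_monom_def)
        ultimately show ?thesis by simp
      qed
    qed
  qed
  thus ?thesis using CS_carrierD[OF f] f by blast
qed

lemma CS_mult_zero:
  assumes f: "f \<in> carrier CS"
  shows "f \<otimes>\<^bsub>CS\<^esub> \<zero>\<^bsub>CS\<^esub> = \<zero>\<^bsub>CS\<^esub>" "\<zero>\<^bsub>CS\<^esub> \<otimes>\<^bsub>CS\<^esub> f = \<zero>\<^bsub>CS\<^esub>"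
  by (simp_all add: crossed_product_def)

lemma crossed_monom_assoc:
  assumes "x \<in> carrier G" "y \<in> carrier G" "z \<in> carrier G" "r \<in> carrier R" "s \<in> carrier R" "t \<in> carrier R"
  shows "crossed_monom R x r \<otimes>\<^bsub>CS\<^esub> crossed_monom R y s \<otimes>\<^bsub>CS\<^esub> crossed_monom R z t =
    crossed_monom R x r \<otimes>\<^bsub>CS\<^esub> (crossed_monom R y s \<otimes>\<^bsub>CS\<^esub> crossed_monom R z t)"
proof -
  note [simp] = assms sigma_closed c_closed
  have "r \<otimes> \<sigma> x s \<otimes> c x y \<otimes> \<sigma> (x \<otimes>\<^bsub>G\<^esub> y) t \<otimes> c (x \<otimes>\<^bsub>G\<^esub> y) z
     = r \<otimes> \<sigma> x s \<otimes> (c x y \<otimes> \<sigma> (x \<otimes>\<^bsub>G\<^esub> y) t) \<otimes> c (x \<otimes>\<^bsub>G\<^esub> y) z" by (simp add: m_assoc)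
  also have "\<dots> = r \<otimes> \<sigma> x s \<otimes> \<sigma> x (\<sigma> y t) \<otimes> (c x y \<otimes> c (x \<otimes>\<^bsub>G\<^esub> y) z)"
    by (simp add: twist[symmetric] m_assoc)
  also have "\<dots> = r \<otimes> \<sigma> x (s \<otimes> \<sigma> y t \<otimes> c y z) \<otimes> c x (y \<otimes>\<^bsub>G\<^esub> z)"
    by (simp add: cocycle sigma_mult m_assoc)
  finally show ?thesis
    by (simp add: crossed_monom_mult G.m_assoc)
qed

theorem crossed_product_ring: "ring CS"
proof -
  interpret CS: abelian_group CS by (rule CS_abelian_group)
  note [simp] = CS_mult_closed crossed_monom_closed CS_distr CS_mult_zero
  show ?thesis
  proof (rule ringI)
    show "monoid CS"
    proof (rule monoidI)
      show one: "\<one>\<^bsub>CS\<^esub> \<in> carrier CS" by (simp add: CS_one)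
      fix f assume f: "f \<in> carrier CS"
      show "\<one>\<^bsub>CS\<^esub> \<otimes>\<^bsub>CS\<^esub> f = f"
        using f by (induction rule: CS_induct)
          (use one in \<open>simp_all\<close>, simp add: CS_one crossed_monom_mult sigma_one c_one_left)
      show "f \<otimes>\<^bsub>CS\<^esub> \<one>\<^bsub>CS\<^esub> = f"
        using f by (induction rule: CS_induct)
          (use one in \<open>simp_all\<close>, simp add: CS_one crossed_monom_mult ring_hom_one[OF sigma_hom] c_one_right)
      fix h assume h: "h \<in> carrier CS"
      show "f \<otimes>\<^bsub>CS\<^esub> h \<in> carrier CS" using f h by simp
      fix i assume i: "i \<in> carrier CS"
      show "f \<otimes>\<^bsub>CS\<^esub> h \<otimes>\<^bsub>CS\<^esub> i = f \<otimes>\<^bsub>CS\<^esub> (h \<otimes>\<^bsub>CS\<^esub> i)"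
        using f
      proof (induction rule: CS_induct)
        case zero thus ?case using h i by simp
      next
        case (add x r f)
        have "crossed_monom R x r \<otimes>\<^bsub>CS\<^esub> h \<otimes>\<^bsub>CS\<^esub> i = crossed_monom R x r \<otimes>\<^bsub>CS\<^esub> (h \<otimes>\<^bsub>CS\<^esub> i)"
          using h
        proof (induction rule: CS_induct)
          case zero thus ?case using add i by simp
        next
          case (add y s h)
          have "crossed_monom R x r \<otimes>\<^bsub>CS\<^esub> crossed_monom R y s \<otimes>\<^bsub>CS\<^esub> i =
            crossed_monom R x r \<otimes>\<^bsub>CS\<^esub> (crossed_monom R y s \<otimes>\<^bsub>CS\<^esub> i)"
            using i
          proof (induction rule: CS_induct)
            case zero thus ?case using add \<open>x \<in> _\<close> \<open>r \<in> _\<close> by simp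
          next
            case (add z t i)
            thus ?case using \<open>x \<in> _\<close> \<open>r \<in> _\<close> \<open>y \<in> _\<close> \<open>s \<in> _\<close> by (simp add: crossed_monom_assoc)
          qed
          thus ?case using add \<open>x \<in> _\<close> \<open>r \<in> _\<close> i by simp
        qed
        thus ?case using add h i by simp
      qed
    qed
  qed (use CS_abelian_group in simp_all)
qed

end

text \<open>\<open>IS\<close>: \<^const>\<open>ideal_prod\<close> consists of the nonempty finite sums of products and does not require
  its arguments to be ideals.\<close>

definition ideal_extension ::
  "('r, 'm) ring_scheme \<Rightarrow> ('g, 'n) monoid_scheme \<Rightarrow> ('g \<Rightarrow> 'r \<Rightarrow> 'r) \<Rightarrow> ('g \<Rightarrow> 'g \<Rightarrow> 'r)
    \<Rightarrow> 'r set \<Rightarrow> ('g \<Rightarrow> 'r) set"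
  where "ideal_extension R G \<sigma> c I =
    crossed_monom R \<one>\<^bsub>G\<^esub> ` I \<cdot>\<^bsub>crossed_product R G \<sigma> c\<^esub> carrier (crossed_product R G \<sigma> c)"

definition S_prime ::
  "('r, 'm) ring_scheme \<Rightarrow> ('g, 'n) monoid_scheme \<Rightarrow> ('g \<Rightarrow> 'r \<Rightarrow> 'r) \<Rightarrow> ('g \<Rightarrow> 'g \<Rightarrow> 'r)
    \<Rightarrow> 'r set \<Rightarrow> bool"
  where "S_prime R G \<sigma> c I \<longleftrightarrow>
    noncomm_primeideal (ideal_extension R G \<sigma> c I) (crossed_product R G \<sigma> c)"

definition pointwise_surjective ::
  "('r, 'm) ring_scheme \<Rightarrow> ('g, 'n) monoid_scheme \<Rightarrow> ('g \<Rightarrow> 'r \<Rightarrow> 'r) \<Rightarrow> bool"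
  where "pointwise_surjective R G \<sigma> \<longleftrightarrow> (\<forall>g\<in>carrier G. \<sigma> g ` carrier R = carrier R)"

definition inner_automorphism :: "('r, 'm) ring_scheme \<Rightarrow> ('r \<Rightarrow> 'r) \<Rightarrow> bool"
  where "inner_automorphism R \<tau> \<longleftrightarrow>
    (\<exists>u\<in>Units R. \<forall>r\<in>carrier R. \<tau> r = u \<otimes>\<^bsub>R\<^esub> r \<otimes>\<^bsub>R\<^esub> inv\<^bsub>R\<^esub> u)"

definition conj_equiv ::
  "('r, 'm) ring_scheme \<Rightarrow> ('g \<Rightarrow> 'r \<Rightarrow> 'r) \<Rightarrow> 'g \<Rightarrow> 'g \<Rightarrow> bool"
  where "conj_equiv R \<sigma> g h \<longleftrightarrow>
    (\<exists>\<tau>. inner_automorphism R \<tau> \<and> (\<forall>r\<in>carrier R. \<sigma> g r = (\<tau> \<circ> \<sigma> h) r))"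

definition reversible_up_to_conjugation ::
  "('r, 'm) ring_scheme \<Rightarrow> ('g, 'n) monoid_scheme \<Rightarrow> ('g \<Rightarrow> 'r \<Rightarrow> 'r) \<Rightarrow> bool"
  where "reversible_up_to_conjugation R G \<sigma> \<longleftrightarrow>
    (\<forall>g\<in>carrier G. \<forall>h\<in>carrier G. \<exists>h1\<in>carrier G. \<exists>h2\<in>carrier G.
      conj_equiv R \<sigma> (g \<otimes>\<^bsub>G\<^esub> h) (h1 \<otimes>\<^bsub>G\<^esub> g) \<and> conj_equiv R \<sigma> (h \<otimes>\<^bsub>G\<^esub> g) (g \<otimes>\<^bsub>G\<^esub> h2))"

definition G_stable :: "('g, 'n) monoid_scheme \<Rightarrow> ('g \<Rightarrow> 'r \<Rightarrow> 'r) \<Rightarrow> 'r set \<Rightarrow> bool"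
  where "G_stable G \<sigma> I \<longleftrightarrow> (\<forall>g\<in>carrier G. \<sigma> g ` I \<subseteq> I)"

definition G_invariant ::
  "('r, 'm) ring_scheme \<Rightarrow> ('g, 'n) monoid_scheme \<Rightarrow> ('g \<Rightarrow> 'r \<Rightarrow> 'r) \<Rightarrow> 'r set \<Rightarrow> bool"
  where "G_invariant R G \<sigma> I \<longleftrightarrow> (\<forall>g\<in>carrier G. {r \<in> carrier R. \<sigma> g r \<in> I} = I)"

end

theory Submission
  imports Defs
begin

text \<open>\<open>IS\<close> is the set of elements of \<open>S\<close> all of whose coefficients lie in \<open>I\<close>. If \<open>IS\<close> is prime and
  \<open>AB \<subseteq> I\<close>, then the left multipliers of \<open>BS\<close> into \<open>IS\<close> form an ideal of \<open>S\<close> containing \<open>A\<close>.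

  Conversely, if \<open>IS\<close> is not prime, choose \<open>f, h \<notin> IS\<close> with \<open>f S h \<subseteq> IS\<close> whose supports modulo \<open>I\<close>
  have minimal total size. A unique product \<open>x\<^sub>0 y\<^sub>0\<close> gives \<open>f(x\<^sub>0) \<sigma>\<^sub>x\<^sub>0(s h(y\<^sub>0)) \<in> I\<close> for all \<open>s \<in> R\<close>, so
  \<open>f s h(y\<^sub>0)\<close> has smaller support than \<open>f\<close> and must lie in \<open>IS\<close>. Then \<open>f(x) r x h\<close> has smaller support
  than \<open>h\<close>, so \<open>f(x) R \<sigma>\<^sub>x(h(y)) \<subseteq> I\<close> for all \<open>x, y\<close>. The same holds for \<open>t h\<close> in place of \<open>h\<close>, which
  leads to \<open>a, b \<notin> I\<close> with \<open>a R \<sigma>\<^sub>t(b) \<subseteq> I\<close> for all \<open>t \<in> G\<close>. The elements \<open>b\<close> with this property for the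
  given \<open>a\<close> form a \<open>G\<close>-stable ideal, which contradicts the condition on \<open>I\<close>.\<close>

section \<open>Membership in ideals and cancellation in unique product monoids\<close>

text \<open>Absorption already yields additive inverses, since
  \<open>\<ominus> a = (\<ominus> \<one>) \<otimes> a\<close>. The ideals constructed below are all
  verified through this criterion.\<close>

lemma (in ring) idealI_closed:
  assumes "J \<subseteq> carrier R" "\<zero> \<in> J"
    and add: "\<And>a b. a \<in> J \<Longrightarrow> b \<in> J \<Longrightarrow> a \<oplus> b \<in> J"
    and l: "\<And>a r. a \<in> J \<Longrightarrow> r \<in> carrier R \<Longrightarrow> r \<otimes> a \<in> J"
    and r: "\<And>a r. a \<in> J \<Longrightarrow> r \<in> carrier R \<Longrightarrow> a \<otimes> r \<in> J"
  shows "ideal J R"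
proof (rule idealI)
  show "subgroup J (add_monoid R)"
  proof (rule add.subgroupI)
    fix a assume a: "a \<in> J"
    hence "\<ominus> a = (\<ominus> \<one>) \<otimes> a" using assms(1) by (auto simp: l_minus)
    thus "\<ominus> a \<in> J" using l[OF a, of "\<ominus> \<one>"] by simp
  qed (use assms in auto)
qed (use assms ring_axioms in auto)

lemma (in ideal) finsum_mem:
  assumes "finite A" "\<And>a. a \<in> A \<Longrightarrow> f a \<in> I"
  shows "(\<Oplus>a\<in>A. f a) \<in> I"
  using assms
proof (induction A)
  case (insert a A)
  hence "f \<in> A \<rightarrow> carrier R" "f a \<in> carrier R" using Icarr by auto
  thus ?case using insert by (simp add: finsum_insert)
qed simp

text \<open>This is what removes the units \<open>c x y\<close> from the coefficients of products
  when membership in an ideal is tested.\<close>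

lemma (in ideal) mult_Unit_right_mem_iff:
  assumes a: "a \<in> carrier R" and u: "u \<in> Units R"
  shows "a \<otimes> u \<in> I \<longleftrightarrow> a \<in> I"
proof
  assume "a \<otimes> u \<in> I"
  hence "a \<otimes> u \<otimes> inv u \<in> I" using u by (blast intro: I_r_closed)
  moreover have "a \<otimes> u \<otimes> inv u = a" using a u by (simp add: m_assoc Units_closed)
  ultimately show "a \<in> I" by simp
qed (use u I_r_closed in auto)

lemma (in ideal) add_mem_iff:
  assumes "a \<in> carrier R" "j \<in> I"
  shows "a \<oplus> j \<in> I \<longleftrightarrow> a \<in> I"
proof
  assume "a \<oplus> j \<in> I"
  hence "(a \<oplus> j) \<oplus> \<ominus> j \<in> I" using assms by blast
  thus "a \<in> I" using assms Icarr by (simp add: a_assoc r_neg)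
qed (use assms in auto)

text \<open>If \<open>y\<close> and \<open>z\<close> were distinct with equal products, the sets
  \<open>{x}\<close> and \<open>{y, z}\<close> would have no unique product.\<close>

lemma (in unique_product_monoid) left_cancel:
  assumes "x \<in> carrier G" "y \<in> carrier G" "z \<in> carrier G" "x \<otimes> y = x \<otimes> z"
  shows "y = z"
  using unique_product[of "{x}" "{y, z}"] assms by auto

section \<open>Coefficients of products in the crossed product\<close>

context crossed_system
begin

definition coeff_ideal :: "'r set \<Rightarrow> ('g \<Rightarrow> 'r) set"
  where "coeff_ideal J = {f \<in> carrier CS. \<forall>x. f x \<in> J}"

lemma sigma_ring_one: "g \<in> carrier G \<Longrightarrow> \<sigma> g \<one> = \<one>"
  by (rule ring_hom_one[OF sigma_hom])

lemma CS_coeff_zero: "f \<in> carrier CS \<Longrightarrow> x \<notin> carrier G \<Longrightarrow> f x = \<zero>"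
  using CS_carrierD(2) by blast

lemma term_closed:
  assumes "f \<in> carrier CS" "h \<in> carrier CS" "x \<in> carrier G" "y \<in> carrier G"
  shows "f x \<otimes> \<sigma> x (h y) \<otimes> c x y \<in> carrier R"
  using assms CS_carrierD(1) by (intro m_closed sigma_closed c_closed) auto

lemma CS_mult_coeff_mem:
  assumes J: "ideal J R" and f: "f \<in> carrier CS" and h: "h \<in> carrier CS"
    and t: "\<And>x y. x \<in> carrier G \<Longrightarrow> y \<in> carrier G \<Longrightarrow> x \<otimes>\<^bsub>G\<^esub> y = k \<Longrightarrow>
      f x \<otimes> \<sigma> x (h y) \<otimes> c x y \<in> J"
  shows "(f \<otimes>\<^bsub>CS\<^esub> h) k \<in> J"
proof -
  interpret J: ideal J R by (rule J)
  note F = CS_carrierD(3,4)[OF f] and H = CS_carrierD(3,4)[OF h]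
  show ?thesis
    unfolding CS_mult_expand[OF f h F subset_refl H subset_refl]
    by (rule J.finsum_mem) (use F H t in \<open>auto simp: subset_iff\<close>)
qed

text \<open>Splits off the contribution of a single pair to a coefficient, modulo \<open>J\<close>.
  It serves for \<open>J = I\<close> at a unique product, and for the zero ideal to obtain exact
  formulas.\<close>

lemma CS_mult_coeff_unique:
  assumes J: "ideal J R" and f: "f \<in> carrier CS" and h: "h \<in> carrier CS"
    and x0: "x0 \<in> carrier G" and y0: "y0 \<in> carrier G"
    and t: "\<And>x y. x \<in> carrier G \<Longrightarrow> y \<in> carrier G \<Longrightarrow> x \<otimes>\<^bsub>G\<^esub> y = x0 \<otimes>\<^bsub>G\<^esub> y0 \<Longrightarrow>
      (x, y) \<noteq> (x0, y0) \<Longrightarrow> f x \<otimes> \<sigma> x (h y) \<otimes> c x y \<in> J"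
  shows "\<exists>j\<in>J. (f \<otimes>\<^bsub>CS\<^esub> h) (x0 \<otimes>\<^bsub>G\<^esub> y0) = f x0 \<otimes> \<sigma> x0 (h y0) \<otimes> c x0 y0 \<oplus> j"
proof -
  interpret J: ideal J R by (rule J)
  \<comment> \<open>The supports are enlarged by \<open>x0\<close> and \<open>y0\<close> so that
    \<open>(x0, y0)\<close> is an index of the sum even if one of the two coefficients
    vanishes.\<close>
  define A where "A = insert x0 {x. f x \<noteq> \<zero>}"
  define B where "B = insert y0 {x. h x \<noteq> \<zero>}"
  have A: "finite A" "A \<subseteq> carrier G" "{x. f x \<noteq> \<zero>} \<subseteq> A"
    using CS_carrierD[OF f] x0 by (auto simp: A_def)
  have B: "finite B" "B \<subseteq> carrier G" "{x. h x \<noteq> \<zero>} \<subseteq> B"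
    using CS_carrierD[OF h] y0 by (auto simp: B_def)
  let ?F = "\<lambda>p. if fst p \<otimes>\<^bsub>G\<^esub> snd p = x0 \<otimes>\<^bsub>G\<^esub> y0
     then f (fst p) \<otimes> \<sigma> (fst p) (h (snd p)) \<otimes> c (fst p) (snd p) else \<zero>"
  have Fc: "?F p \<in> carrier R" if "p \<in> A \<times> B" for p
    using that A(2) B(2) term_closed[OF f h] by (auto simp: subset_iff)
  have AB: "A \<times> B = insert (x0, y0) (A \<times> B - {(x0, y0)})" by (auto simp: A_def B_def)
  have "(f \<otimes>\<^bsub>CS\<^esub> h) (x0 \<otimes>\<^bsub>G\<^esub> y0) = (\<Oplus>p\<in>A\<times>B. ?F p)"
    by (rule CS_mult_expand[OF f h A B])
  also have "\<dots> = ?F (x0, y0) \<oplus> (\<Oplus>p\<in>A\<times>B - {(x0, y0)}. ?F p)"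
    by (subst AB, rule finsum_insert) (use A B Fc x0 y0 term_closed[OF f h] in auto)
  finally have "(f \<otimes>\<^bsub>CS\<^esub> h) (x0 \<otimes>\<^bsub>G\<^esub> y0) =
      f x0 \<otimes> \<sigma> x0 (h y0) \<otimes> c x0 y0 \<oplus> (\<Oplus>p\<in>A\<times>B - {(x0, y0)}. ?F p)"
    by simp
  moreover have "(\<Oplus>p\<in>A\<times>B - {(x0, y0)}. ?F p) \<in> J"
  proof (rule J.finsum_mem)
    show "finite (A \<times> B - {(x0, y0)})" using A(1) B(1) by simp
    fix p assume p: "p \<in> A \<times> B - {(x0, y0)}"
    hence "fst p \<in> carrier G" "snd p \<in> carrier G" "(fst p, snd p) \<noteq> (x0, y0)"
      using A(2) B(2) by auto
    thus "?F p \<in> J" using t[of "fst p" "snd p"] by simp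
  qed
  ultimately show ?thesis by blast
qed

text \<open>Taking the zero ideal for \<open>J\<close> turns the congruence of
  \<open>CS_mult_coeff_unique\<close> into an equality.\<close>

lemma CS_mult_coeff_eq:
  assumes f: "f \<in> carrier CS" and h: "h \<in> carrier CS"
    and x0: "x0 \<in> carrier G" and y0: "y0 \<in> carrier G"
    and t: "\<And>x y. x \<in> carrier G \<Longrightarrow> y \<in> carrier G \<Longrightarrow> x \<otimes>\<^bsub>G\<^esub> y = x0 \<otimes>\<^bsub>G\<^esub> y0 \<Longrightarrow>
      (x, y) \<noteq> (x0, y0) \<Longrightarrow> f x = \<zero> \<or> h y = \<zero>"
  shows "(f \<otimes>\<^bsub>CS\<^esub> h) (x0 \<otimes>\<^bsub>G\<^esub> y0) = f x0 \<otimes> \<sigma> x0 (h y0) \<otimes> c x0 y0"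
proof -
  have "f x \<otimes> \<sigma> x (h y) \<otimes> c x y \<in> {\<zero>}"
    if "x \<in> carrier G" "y \<in> carrier G" "x \<otimes>\<^bsub>G\<^esub> y = x0 \<otimes>\<^bsub>G\<^esub> y0" "(x, y) \<noteq> (x0, y0)" for x y
    using t[OF that] that CS_carrierD(1)[OF f] CS_carrierD(1)[OF h]
    by (auto simp: sigma_zero sigma_closed c_closed)
  from CS_mult_coeff_unique[OF zeroideal f h x0 y0 this]
  have "(f \<otimes>\<^bsub>CS\<^esub> h) (x0 \<otimes>\<^bsub>G\<^esub> y0) = f x0 \<otimes> \<sigma> x0 (h y0) \<otimes> c x0 y0 \<oplus> \<zero>"
    by blast
  thus ?thesis by (simp only: r_zero[OF term_closed[OF f h x0 y0]])
qed

lemma CS_mult_monom_one_right: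
  assumes f: "f \<in> carrier CS" and s: "s \<in> carrier R" and x: "x \<in> carrier G"
  shows "(f \<otimes>\<^bsub>CS\<^esub> crossed_monom R \<one>\<^bsub>G\<^esub> s) x = f x \<otimes> \<sigma> x s"
proof -
  have "(f \<otimes>\<^bsub>CS\<^esub> crossed_monom R \<one>\<^bsub>G\<^esub> s) (x \<otimes>\<^bsub>G\<^esub> \<one>\<^bsub>G\<^esub>) =
      f x \<otimes> \<sigma> x (crossed_monom R \<one>\<^bsub>G\<^esub> s \<one>\<^bsub>G\<^esub>) \<otimes> c x \<one>\<^bsub>G\<^esub>"
    by (rule CS_mult_coeff_eq) (use f s x in \<open>auto simp: crossed_monom_closed\<close>,
        use G.r_one in \<open>auto simp: crossed_monom_def split: if_splits\<close>)
  thus ?thesis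
    using x s CS_carrierD(1)[OF f] by (simp add: crossed_monom_def c_one_right sigma_closed)
qed

lemma CS_mult_monom_one_left:
  assumes f: "f \<in> carrier CS" and s: "s \<in> carrier R" and x: "x \<in> carrier G"
  shows "(crossed_monom R \<one>\<^bsub>G\<^esub> s \<otimes>\<^bsub>CS\<^esub> f) x = s \<otimes> f x"
proof -
  have "(crossed_monom R \<one>\<^bsub>G\<^esub> s \<otimes>\<^bsub>CS\<^esub> f) (\<one>\<^bsub>G\<^esub> \<otimes>\<^bsub>G\<^esub> x) =
      crossed_monom R \<one>\<^bsub>G\<^esub> s \<one>\<^bsub>G\<^esub> \<otimes> \<sigma> \<one>\<^bsub>G\<^esub> (f x) \<otimes> c \<one>\<^bsub>G\<^esub> x"
    by (rule CS_mult_coeff_eq) (use f s x in \<open>auto simp: crossed_monom_closed\<close>, auto simp: crossed_monom_def)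
  thus ?thesis
    using x s CS_carrierD(1)[OF f] by (simp add: crossed_monom_def c_one_left sigma_one)
qed

section \<open>Extension of ideals of \<open>R\<close> to the crossed product\<close>

text \<open>A left factor at \<open>x\<close> twists the coefficients of \<open>h\<close> by
  \<open>\<sigma> x\<close>, and stability keeps the twisted coefficients in
  \<open>J\<close>.\<close>

lemma coeff_ideal_l_closed:
  assumes J: "ideal J R" and st: "G_stable G \<sigma> J"
    and f: "f \<in> carrier CS" and h: "h \<in> coeff_ideal J"
  shows "f \<otimes>\<^bsub>CS\<^esub> h \<in> coeff_ideal J"
proof -
  interpret J: ideal J R by (rule J)
  have h': "h \<in> carrier CS" "\<And>y. h y \<in> J" using h by (auto simp: coeff_ideal_def)
  have "(f \<otimes>\<^bsub>CS\<^esub> h) k \<in> J" for k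
  proof (rule CS_mult_coeff_mem[OF J f h'(1)])
    fix x y assume xy: "x \<in> carrier G" "y \<in> carrier G"
    have "\<sigma> x (h y) \<in> J" using st xy(1) h'(2) by (auto simp: G_stable_def)
    thus "f x \<otimes> \<sigma> x (h y) \<otimes> c x y \<in> J"
      using CS_carrierD(1)[OF f] c_closed[OF xy] J.I_l_closed J.I_r_closed by auto
  qed
  thus ?thesis using CS_mult_closed[OF f h'(1)] by (simp add: coeff_ideal_def)
qed

lemma coeff_ideal_r_closed:
  assumes J: "ideal J R" and f: "f \<in> coeff_ideal J" and h: "h \<in> carrier CS"
  shows "f \<otimes>\<^bsub>CS\<^esub> h \<in> coeff_ideal J"
proof -
  interpret J: ideal J R by (rule J)
  have f': "f \<in> carrier CS" "\<And>y. f y \<in> J" using f by (auto simp: coeff_ideal_def)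
  have "(f \<otimes>\<^bsub>CS\<^esub> h) k \<in> J" for k
  proof (rule CS_mult_coeff_mem[OF J f'(1) h])
    fix x y assume xy: "x \<in> carrier G" "y \<in> carrier G"
    show "f x \<otimes> \<sigma> x (h y) \<otimes> c x y \<in> J"
      using f'(2) sigma_closed[OF xy(1) CS_carrierD(1)[OF h]] c_closed[OF xy] J.I_r_closed by simp
  qed
  thus ?thesis using CS_mult_closed[OF f'(1) h] by (simp add: coeff_ideal_def)
qed

lemma coeff_ideal_add_closed:
  assumes J: "ideal J R" and "f \<in> coeff_ideal J" "h \<in> coeff_ideal J"
  shows "f \<oplus>\<^bsub>CS\<^esub> h \<in> coeff_ideal J"
proof -
  interpret J: ideal J R by (rule J)
  interpret CS: abelian_group CS by (rule CS_abelian_group)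
  show ?thesis using assms CS.a_closed by (auto simp: coeff_ideal_def CS_add)
qed

lemma coeff_ideal_is_ideal:
  assumes J: "ideal J R" and st: "G_stable G \<sigma> J"
  shows "ideal (coeff_ideal J) CS"
proof (rule ring.idealI_closed[OF crossed_product_ring])
  interpret J: ideal J R by (rule J)
  interpret CS: abelian_group CS by (rule CS_abelian_group)
  show "\<zero>\<^bsub>CS\<^esub> \<in> coeff_ideal J" using CS.zero_closed by (auto simp: coeff_ideal_def CS_zero)
  show "coeff_ideal J \<subseteq> carrier CS" by (auto simp: coeff_ideal_def)
qed (rule coeff_ideal_add_closed[OF J] coeff_ideal_l_closed[OF J st] coeff_ideal_r_closed[OF J];
    assumption)+

lemma monom_in_coeff_ideal:
  assumes "ideal J R" "g \<in> carrier G" "r \<in> J"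
  shows "crossed_monom R g r \<in> coeff_ideal J"
proof -
  interpret J: ideal J R by (rule assms)
  show ?thesis using assms J.Icarr crossed_monom_closed
    by (auto simp: coeff_ideal_def crossed_monom_def)
qed

text \<open>An element with coefficients in \<open>J\<close> is a finite sum of monomials, and a
  monomial with coefficient \<open>r\<close> at \<open>g\<close> is the product of \<open>r\<close>
  at the identity with \<open>\<one>\<close> at \<open>g\<close>. The sum is built by induction over
  a finite set containing the support.\<close>

lemma ideal_extension_eq_coeff_ideal:
  assumes J: "ideal J R"
  shows "ideal_extension R G \<sigma> c J = coeff_ideal J"
proof
  interpret J: ideal J R by (rule J)
  show "ideal_extension R G \<sigma> c J \<subseteq> coeff_ideal J"
  proof
    fix f assume "f \<in> ideal_extension R G \<sigma> c J"
    thus "f \<in> coeff_ideal J" unfolding ideal_extension_def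
    proof (induction rule: ideal_prod.induct)
      case (prod i j)
      thus ?case using coeff_ideal_r_closed[OF J] monom_in_coeff_ideal[OF J G.one_closed] by auto
    qed (rule coeff_ideal_add_closed[OF J])
  qed
  have monom: "crossed_monom R g r \<in> ideal_extension R G \<sigma> c J" if "g \<in> carrier G" "r \<in> J" for g r
  proof -
    have "crossed_monom R g r = crossed_monom R \<one>\<^bsub>G\<^esub> r \<otimes>\<^bsub>CS\<^esub> crossed_monom R g \<one>"
      using that J.Icarr by (simp add: crossed_monom_mult sigma_one c_one_left)
    thus ?thesis unfolding ideal_extension_def
      using that crossed_monom_closed by (auto intro!: ideal_prod.prod)
  qed
  \<comment> \<open>An ideal product is generated by nonempty sums only, so zero has to be exhibited
    as a monomial with coefficient \<open>\<zero>\<close>.\<close>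
  have zero: "\<zero>\<^bsub>CS\<^esub> \<in> ideal_extension R G \<sigma> c J"
  proof -
    have "crossed_monom R \<one>\<^bsub>G\<^esub> \<zero> = \<zero>\<^bsub>CS\<^esub>" by (auto simp: crossed_monom_def CS_zero)
    thus ?thesis using monom[OF G.one_closed, of \<zero>] by simp
  qed
  have "f \<in> ideal_extension R G \<sigma> c J"
    if "finite A" "f \<in> coeff_ideal J" "{x. f x \<noteq> \<zero>} \<subseteq> A" for A f
    using that
  proof (induction A arbitrary: f)
    case empty
    hence "f = \<zero>\<^bsub>CS\<^esub>" by (auto simp: CS_zero)
    thus ?case using zero by simp
  next
    case (insert b A)
    have f: "f \<in> carrier CS" "\<And>x. f x \<in> J" using insert.prems by (auto simp: coeff_ideal_def)
    have "f(b := \<zero>) \<in> carrier CS"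
      by (rule CS_carrierI[of _ "{x. f x \<noteq> \<zero>}"]) (use CS_carrierD[OF f(1)] in auto)
    moreover have "(f(b := \<zero>)) x \<in> J" for x using f(2) by simp
    ultimately have "f(b := \<zero>) \<in> coeff_ideal J" unfolding coeff_ideal_def by blast
    moreover have "{x. (f(b := \<zero>)) x \<noteq> \<zero>} \<subseteq> A" using insert.prems by auto
    ultimately have h: "f(b := \<zero>) \<in> ideal_extension R G \<sigma> c J" by (rule insert.IH)
    have eq: "f = crossed_monom R b (f b) \<oplus>\<^bsub>CS\<^esub> f(b := \<zero>)"
      using CS_carrierD(1)[OF f(1)] by (auto simp: CS_add crossed_monom_def)
    \<comment> \<open>\<open>A\<close> is an arbitrary finite set, so \<open>b\<close> is known to
      lie in \<open>carrier G\<close> only when \<open>f b \<noteq> \<zero>\<close>.\<close>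
    show ?case
    proof (cases "f b = \<zero>")
      case True
      hence "f(b := \<zero>) = f" by auto
      thus ?thesis using h by simp
    next
      case False
      hence "crossed_monom R b (f b) \<in> ideal_extension R G \<sigma> c J"
        using monom f CS_carrierD(2)[OF f(1)] by blast
      thus ?thesis using h ideal_prod.sum eq unfolding ideal_extension_def by metis
    qed
  qed
  thus "coeff_ideal J \<subseteq> ideal_extension R G \<sigma> c J"
    using CS_carrierD(3) by (auto simp: coeff_ideal_def)
qed

lemma coeff_ideal_subset_iff:
  assumes "ideal J R" and "ideal K R"
  shows "coeff_ideal J \<subseteq> coeff_ideal K \<longleftrightarrow> J \<subseteq> K"
proof
  assume s: "coeff_ideal J \<subseteq> coeff_ideal K"
  show "J \<subseteq> K"
  proof
    fix r assume "r \<in> J"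
    hence "crossed_monom R \<one>\<^bsub>G\<^esub> r \<in> coeff_ideal K"
      using s monom_in_coeff_ideal[OF assms(1) G.one_closed] by blast
    hence "crossed_monom R \<one>\<^bsub>G\<^esub> r \<one>\<^bsub>G\<^esub> \<in> K" by (simp add: coeff_ideal_def)
    thus "r \<in> K" by (simp add: crossed_monom_def)
  qed
qed (auto simp: coeff_ideal_def)

section \<open>Primeness of the extension implies the condition on ideals of
  \<open>R\<close>\<close>

lemma ideal_prod_subset_if_coeff_ideal_prime:
  assumes I: "ideal I R" "G_stable G \<sigma> I" and prime: "noncomm_primeideal (coeff_ideal I) CS"
    and A: "ideal A R" and B: "ideal B R" "G_stable G \<sigma> B" and AB: "A \<cdot> B \<subseteq> I"
  shows "A \<subseteq> I \<or> B \<subseteq> I"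
proof -
  interpret CS: ring CS by (rule crossed_product_ring)
  interpret I: ideal I R by (rule I)
  interpret A: ideal A R by (rule A)
  interpret B: ideal B R by (rule B)
  interpret IS: noncomm_primeideal "coeff_ideal I" CS by (rule prime)
  interpret BS: ideal "coeff_ideal B" CS by (rule coeff_ideal_is_ideal[OF B])
  \<comment> \<open>\<open>A\<close> may fail to be \<open>G\<close>-stable, and then
    \<open>coeff_ideal A\<close> may fail to be an ideal of \<open>CS\<close>. The multiplier ideal
    \<open>L\<close> takes its place.\<close>
  define L where "L = {f \<in> carrier CS. \<forall>h\<in>coeff_ideal B. f \<otimes>\<^bsub>CS\<^esub> h \<in> coeff_ideal I}"
  have L: "ideal L CS"
  proof (rule CS.idealI_closed)
    show "L \<subseteq> carrier CS" by (auto simp: L_def)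
    show "\<zero>\<^bsub>CS\<^esub> \<in> L" using BS.Icarr by (simp add: L_def)
    fix f h assume f: "f \<in> L"
    show "f \<oplus>\<^bsub>CS\<^esub> h \<in> L" if "h \<in> L"
      using f that BS.Icarr by (auto simp: L_def CS.l_distr)
    assume h: "h \<in> carrier CS"
    \<comment> \<open>Closure under right factors uses that \<open>coeff_ideal B\<close> is closed
      under left multiplication, which rests on the stability of \<open>B\<close>.\<close>
    show "h \<otimes>\<^bsub>CS\<^esub> f \<in> L" "f \<otimes>\<^bsub>CS\<^esub> h \<in> L"
      using f h BS.Icarr BS.I_l_closed IS.I_l_closed by (auto simp: L_def CS.m_assoc)
  qed
  have "L \<cdot>\<^bsub>CS\<^esub> coeff_ideal B \<subseteq> coeff_ideal I"
  proof
    fix f assume "f \<in> L \<cdot>\<^bsub>CS\<^esub> coeff_ideal B"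
    thus "f \<in> coeff_ideal I" by induction (auto simp: L_def)
  qed
  hence "L \<subseteq> coeff_ideal I \<or> coeff_ideal B \<subseteq> coeff_ideal I"
    by (rule IS.P_prime[OF L BS.is_ideal])
  moreover have "A \<subseteq> I" if "L \<subseteq> coeff_ideal I"
  proof
    fix a assume a: "a \<in> A"
    have "crossed_monom R \<one>\<^bsub>G\<^esub> a \<otimes>\<^bsub>CS\<^esub> h \<in> coeff_ideal I" if h: "h \<in> coeff_ideal B" for h
    proof -
      have hc: "h \<in> carrier CS" "\<And>x. h x \<in> B" using h unfolding coeff_ideal_def by blast+
      have ac: "a \<in> carrier R" using a A.Icarr by blast
      have I_B: "a \<otimes> b \<in> I" if "b \<in> B" for b
        using AB ideal_prod.prod[of a A b B R] a that by auto
      hence "(crossed_monom R \<one>\<^bsub>G\<^esub> a \<otimes>\<^bsub>CS\<^esub> h) x \<in> I" for x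
        using CS_mult_monom_one_left[OF hc(1) ac, of x] I_B[OF hc(2)] I.zero_closed
          CS_coeff_zero[OF CS_mult_closed[OF crossed_monom_closed[OF G.one_closed ac] hc(1)], of x]
        by (cases "x \<in> carrier G") simp_all
      thus ?thesis using CS_mult_closed[OF crossed_monom_closed[OF G.one_closed ac] hc(1)]
        unfolding coeff_ideal_def by blast
    qed
    hence "crossed_monom R \<one>\<^bsub>G\<^esub> a \<in> L"
      unfolding L_def using crossed_monom_closed[OF G.one_closed A.Icarr[OF a]] by blast
    hence "crossed_monom R \<one>\<^bsub>G\<^esub> a \<in> coeff_ideal I" using that by blast
    hence "crossed_monom R \<one>\<^bsub>G\<^esub> a \<one>\<^bsub>G\<^esub> \<in> I" unfolding coeff_ideal_def by blast
    thus "a \<in> I" by (simp add: crossed_monom_def)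
  qed
  ultimately show ?thesis using coeff_ideal_subset_iff[OF B(1) I(1)] by blast
qed

end

section \<open>Commutative coefficient rings\<close>

context crossed_system
begin

text \<open>Over a commutative ring the unit \<open>c g h\<close> cancels from \<open>twist\<close>,
  so \<open>\<sigma>\<close> becomes an honest action of the monoid.\<close>

lemma sigma_comp_of_cring:
  assumes "cring R" "g \<in> carrier G" "h \<in> carrier G" "r \<in> carrier R"
  shows "\<sigma> g (\<sigma> h r) = \<sigma> (g \<otimes>\<^bsub>G\<^esub> h) r"
proof -
  interpret C: cring R by (rule assms)
  note u = c_unit[OF assms(2,3)]
  have c: "\<sigma> g (\<sigma> h r) \<in> carrier R" "\<sigma> (g \<otimes>\<^bsub>G\<^esub> h) r \<in> carrier R"
    using assms sigma_closed by simp_all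
  have "c g h \<otimes> \<sigma> g (\<sigma> h r) = c g h \<otimes> \<sigma> (g \<otimes>\<^bsub>G\<^esub> h) r"
    using twist[OF assms(2-4)] C.m_comm[OF c(1) Units_closed[OF u]] by simp
  thus ?thesis using Units_l_cancel[OF u c] by blast
qed

text \<open>Inner automorphisms of a commutative ring are trivial, so reversibility up to
  conjugation yields equalities of maps.\<close>

lemma conj_equivD_of_cring:
  assumes "cring R" "conj_equiv R \<sigma> g h" "r \<in> carrier R" "h \<in> carrier G"
  shows "\<sigma> g r = \<sigma> h r"
proof -
  interpret C: cring R by (rule assms)
  obtain u where u: "u \<in> Units R" "\<sigma> g r = u \<otimes> \<sigma> h r \<otimes> inv u"
    using assms(2-4) sigma_closed[OF assms(4,3)]
    unfolding conj_equiv_def inner_automorphism_def by auto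
  have "u \<otimes> \<sigma> h r \<otimes> inv u = \<sigma> h r \<otimes> (u \<otimes> inv u)"
    using u(1) sigma_closed[OF assms(4,3)] by (simp add: C.m_comm[of u "\<sigma> h r"] m_assoc Units_closed)
  thus ?thesis using u sigma_closed[OF assms(4,3)] by simp
qed

end

section \<open>Annihilating pairs and supports modulo \<open>I\<close>\<close>

locale invariant_ideal_system = crossed_system R G \<sigma> c + G: unique_product_monoid G + I: ideal I R
  for R :: "('r, 'm) ring_scheme" (structure) and G :: "('g, 'n) monoid_scheme" (structure)
    and \<sigma> :: "'g \<Rightarrow> 'r \<Rightarrow> 'r" and c :: "'g \<Rightarrow> 'g \<Rightarrow> 'r" and I :: "'r set" +
  assumes invariant: "G_invariant R G \<sigma> I"
begin

text \<open>This is the support of the image of \<open>f\<close> over \<open>R/I\<close>; working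
  with representatives avoids forming the quotient crossed product.\<close>

definition isupp :: "('g \<Rightarrow> 'r) \<Rightarrow> 'g set"
  where "isupp f = {x. f x \<notin> I}"

definition weight :: "('g \<Rightarrow> 'r) \<Rightarrow> ('g \<Rightarrow> 'r) \<Rightarrow> nat"
  where "weight f h = card (isupp f) + card (isupp h)"

definition annihilating :: "('g \<Rightarrow> 'r) \<Rightarrow> ('g \<Rightarrow> 'r) \<Rightarrow> bool"
  where "annihilating f h \<longleftrightarrow> f \<in> carrier CS - coeff_ideal I \<and> h \<in> carrier CS - coeff_ideal I \<and>
    (\<forall>s\<in>carrier CS. f \<otimes>\<^bsub>CS\<^esub> s \<otimes>\<^bsub>CS\<^esub> h \<in> coeff_ideal I)"

lemma annihilatingD:
  assumes "annihilating f h"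
  shows "f \<in> carrier CS" "f \<in> carrier CS - coeff_ideal I" "h \<in> carrier CS" "h \<in> carrier CS - coeff_ideal I"
    "s \<in> carrier CS \<Longrightarrow> f \<otimes>\<^bsub>CS\<^esub> s \<otimes>\<^bsub>CS\<^esub> h \<in> coeff_ideal I"
  using assms unfolding annihilating_def by blast+

text \<open>Minimizing the total size allows either entry to be shrunk while the other one is
  kept.\<close>

definition minimal_annihilating :: "('g \<Rightarrow> 'r) \<Rightarrow> ('g \<Rightarrow> 'r) \<Rightarrow> bool"
  where "minimal_annihilating f h \<longleftrightarrow>
    annihilating f h \<and> (\<forall>f' h'. annihilating f' h' \<longrightarrow> weight f h \<le> weight f' h')"

lemma minimal_annihilatingD:
  assumes "minimal_annihilating f h"
  shows "annihilating f h" "annihilating f' h' \<Longrightarrow> weight f h \<le> weight f' h'"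
  using assms unfolding minimal_annihilating_def by blast+

text \<open>Invariance says that \<open>\<sigma> g\<close> induces a well-defined and injective map
  on \<open>R/I\<close>.\<close>

lemma sigma_mem_iff: "g \<in> carrier G \<Longrightarrow> r \<in> carrier R \<Longrightarrow> \<sigma> g r \<in> I \<longleftrightarrow> r \<in> I"
  using invariant by (auto simp: G_invariant_def)

lemma stable: "G_stable G \<sigma> I"
  using sigma_mem_iff I.Icarr by (auto simp: G_stable_def)

lemma isupp_subset_carrier: "f \<in> carrier CS \<Longrightarrow> isupp f \<subseteq> carrier G"
  using CS_coeff_zero I.zero_closed by (fastforce simp: isupp_def)

lemma finite_isupp:
  assumes "f \<in> carrier CS"
  shows "finite (isupp f)"
proof (rule finite_subset)
  show "isupp f \<subseteq> {x. f x \<noteq> \<zero>}" using I.zero_closed by (auto simp: isupp_def)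
qed (rule CS_carrierD(3)[OF assms])

lemma isupp_nonempty: "f \<in> carrier CS - coeff_ideal I \<Longrightarrow> isupp f \<noteq> {}"
  by (auto simp: isupp_def coeff_ideal_def)

text \<open>By left cancellation, \<open>y\<close> is the only index of \<open>h\<close> that the
  monomial moves to the product of \<open>x\<close> and \<open>y\<close>.\<close>

lemma monom_mult_coeff:
  assumes "x \<in> carrier G" "y \<in> carrier G" "r \<in> carrier R" "h \<in> carrier CS"
  shows "(crossed_monom R x r \<otimes>\<^bsub>CS\<^esub> h) (x \<otimes>\<^bsub>G\<^esub> y) = r \<otimes> \<sigma> x (h y) \<otimes> c x y"
proof -
  have "(crossed_monom R x r \<otimes>\<^bsub>CS\<^esub> h) (x \<otimes>\<^bsub>G\<^esub> y) =
      crossed_monom R x r x \<otimes> \<sigma> x (h y) \<otimes> c x y"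
  proof (rule CS_mult_coeff_eq)
    fix x' y' assume *: "x' \<in> carrier G" "y' \<in> carrier G" "x' \<otimes>\<^bsub>G\<^esub> y' = x \<otimes>\<^bsub>G\<^esub> y" "(x', y') \<noteq> (x, y)"
    hence "x' \<noteq> x" using assms G.left_cancel[of x y' y] by blast
    thus "crossed_monom R x r x' = \<zero> \<or> h y' = \<zero>" by (simp add: crossed_monom_def)
  qed (use assms crossed_monom_closed in auto)
  thus ?thesis by (simp add: crossed_monom_def)
qed

text \<open>A coefficient outside \<open>I\<close> requires a term outside \<open>I\<close>, and the
  monomial has terms only at \<open>x\<close>. Hence the support modulo \<open>I\<close> cannot grow
  in size, and it shrinks once \<open>r \<otimes> \<sigma> x (h y)\<close> falls into
  \<open>I\<close> for some \<open>y\<close> in \<open>isupp h\<close>.\<close>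

lemma isupp_monom_mult:
  assumes x: "x \<in> carrier G" and r: "r \<in> carrier R" and h: "h \<in> carrier CS"
  shows "isupp (crossed_monom R x r \<otimes>\<^bsub>CS\<^esub> h) \<subseteq> (\<lambda>y. x \<otimes>\<^bsub>G\<^esub> y) ` {y \<in> isupp h. r \<otimes> \<sigma> x (h y) \<notin> I}"
proof
  let ?m = "crossed_monom R x r"
  note m = crossed_monom_closed[OF x r]
  fix k assume "k \<in> isupp (?m \<otimes>\<^bsub>CS\<^esub> h)"
  hence "(?m \<otimes>\<^bsub>CS\<^esub> h) k \<notin> I" by (simp add: isupp_def)
  then obtain x' y where y: "x' \<in> carrier G" "y \<in> carrier G" "x' \<otimes>\<^bsub>G\<^esub> y = k"
      "?m x' \<otimes> \<sigma> x' (h y) \<otimes> c x' y \<notin> I"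
    using CS_mult_coeff_mem[OF I.is_ideal m h, of k] by blast
  note hy = CS_carrierD(1)[OF h, of y]
  have n: "?m x' \<otimes> \<sigma> x' (h y) \<notin> I"
    using y I.I_r_closed c_closed by blast
  have x': "x' = x"
  proof (rule ccontr)
    assume "x' \<noteq> x"
    hence "?m x' \<otimes> \<sigma> x' (h y) = \<zero>" using sigma_closed[OF y(1) hy] by (simp add: crossed_monom_def)
    thus False using n I.zero_closed by simp
  qed
  hence n': "r \<otimes> \<sigma> x (h y) \<notin> I" using n by (simp add: crossed_monom_def)
  hence "h y \<notin> I" using sigma_mem_iff[OF x hy] I.I_l_closed r by blast
  thus "k \<in> (\<lambda>y. x \<otimes>\<^bsub>G\<^esub> y) ` {y \<in> isupp h. r \<otimes> \<sigma> x (h y) \<notin> I}"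
    using n' y(3) x' by (auto simp: isupp_def)
qed

lemma card_isupp_monom_mult:
  assumes x: "x \<in> carrier G" and r: "r \<in> carrier R" and h: "h \<in> carrier CS"
  shows "card (isupp (crossed_monom R x r \<otimes>\<^bsub>CS\<^esub> h)) \<le> card {y \<in> isupp h. r \<otimes> \<sigma> x (h y) \<notin> I}"
  by (rule surj_card_le[OF _ isupp_monom_mult[OF assms]]) (use finite_isupp[OF h] in simp)

text \<open>The new factor \<open>m\<close> is absorbed into the arbitrary middle factor
  \<open>s\<close>; \<open>annihilating_mult_right\<close> works in the same way on the other
  side.\<close>

lemma annihilating_mult_left:
  assumes a: "annihilating f h" and m: "m \<in> carrier CS" and n: "m \<otimes>\<^bsub>CS\<^esub> h \<notin> coeff_ideal I"
  shows "annihilating f (m \<otimes>\<^bsub>CS\<^esub> h)"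
proof -
  interpret CS: ring CS by (rule crossed_product_ring)
  note fh = annihilatingD(1,3)[OF a]
  have "f \<otimes>\<^bsub>CS\<^esub> s \<otimes>\<^bsub>CS\<^esub> (m \<otimes>\<^bsub>CS\<^esub> h) \<in> coeff_ideal I" if s: "s \<in> carrier CS" for s
  proof -
    have "f \<otimes>\<^bsub>CS\<^esub> s \<otimes>\<^bsub>CS\<^esub> (m \<otimes>\<^bsub>CS\<^esub> h) = f \<otimes>\<^bsub>CS\<^esub> (s \<otimes>\<^bsub>CS\<^esub> m) \<otimes>\<^bsub>CS\<^esub> h"
      using fh s m by (simp add: CS.m_assoc)
    thus ?thesis using annihilatingD(5)[OF a, of "s \<otimes>\<^bsub>CS\<^esub> m"] s m CS.m_closed by simp
  qed
  thus ?thesis using annihilatingD[OF a] n m CS.m_closed unfolding annihilating_def by blast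
qed

lemma annihilating_mult_right:
  assumes a: "annihilating f h" and m: "m \<in> carrier CS" and n: "f \<otimes>\<^bsub>CS\<^esub> m \<notin> coeff_ideal I"
  shows "annihilating (f \<otimes>\<^bsub>CS\<^esub> m) h"
proof -
  interpret CS: ring CS by (rule crossed_product_ring)
  note fh = annihilatingD(1,3)[OF a]
  have "f \<otimes>\<^bsub>CS\<^esub> m \<otimes>\<^bsub>CS\<^esub> s \<otimes>\<^bsub>CS\<^esub> h \<in> coeff_ideal I" if s: "s \<in> carrier CS" for s
  proof -
    have "f \<otimes>\<^bsub>CS\<^esub> m \<otimes>\<^bsub>CS\<^esub> s \<otimes>\<^bsub>CS\<^esub> h = f \<otimes>\<^bsub>CS\<^esub> (m \<otimes>\<^bsub>CS\<^esub> s) \<otimes>\<^bsub>CS\<^esub> h"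
      using fh s m by (simp add: CS.m_assoc)
    thus ?thesis using annihilatingD(5)[OF a, of "m \<otimes>\<^bsub>CS\<^esub> s"] s m CS.m_closed by simp
  qed
  thus ?thesis using annihilatingD[OF a] n m CS.m_closed unfolding annihilating_def by blast
qed

section \<open>Unique products and minimal annihilating pairs\<close>

lemma annihilating_unique_product:
  assumes a: "annihilating f h"
  obtains x y where "x \<in> isupp f" "y \<in> isupp h"
    "\<And>s. s \<in> carrier R \<Longrightarrow> f x \<otimes> \<sigma> x s \<otimes> \<sigma> x (h y) \<in> I"
proof -
  note f = annihilatingD(1,2)[OF a] and h = annihilatingD(3,4)[OF a]
  obtain x y where xy: "x \<in> isupp f" "y \<in> isupp h"
    and u: "\<And>x' y'. x' \<in> isupp f \<Longrightarrow> y' \<in> isupp h \<Longrightarrow> (x', y') \<noteq> (x, y) \<Longrightarrow>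
      x \<otimes>\<^bsub>G\<^esub> y \<noteq> x' \<otimes>\<^bsub>G\<^esub> y'"
    using G.unique_product[OF isupp_subset_carrier[OF f(1)] isupp_subset_carrier[OF h(1)]
      finite_isupp[OF f(1)] finite_isupp[OF h(1)] isupp_nonempty[OF f(2)] isupp_nonempty[OF h(2)]]
    by metis
  have xyG: "x \<in> carrier G" "y \<in> carrier G"
    using xy isupp_subset_carrier f(1) h(1) by blast+
  have "f x \<otimes> \<sigma> x s \<otimes> \<sigma> x (h y) \<in> I" if s: "s \<in> carrier R" for s
  proof -
    let ?m = "crossed_monom R \<one>\<^bsub>G\<^esub> s"
    let ?F = "f \<otimes>\<^bsub>CS\<^esub> ?m"
    have m: "?m \<in> carrier CS" using s by (simp add: crossed_monom_closed)
    have F: "?F \<in> carrier CS" using f m by (simp add: CS_mult_closed)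
    \<comment> \<open>Any other pair with the same product leaves one of the two supports, so one of
      its coefficients is in \<open>I\<close>.\<close>
    have "?F x' \<otimes> \<sigma> x' (h y') \<otimes> c x' y' \<in> I"
      if g: "x' \<in> carrier G" "y' \<in> carrier G" and e: "x' \<otimes>\<^bsub>G\<^esub> y' = x \<otimes>\<^bsub>G\<^esub> y"
        and ne: "(x', y') \<noteq> (x, y)" for x' y'
    proof -
      have Fx: "?F x' = f x' \<otimes> \<sigma> x' s" by (rule CS_mult_monom_one_right[OF f(1) s g(1)])
      have hy: "h y' \<in> carrier R" by (rule CS_carrierD(1)[OF h(1)])
      have "f x' \<in> I \<or> h y' \<in> I" using u[of x' y'] e ne by (auto simp: isupp_def)
      hence "?F x' \<in> I \<or> \<sigma> x' (h y') \<in> I"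
        using Fx I.I_r_closed sigma_closed[OF g(1) s] sigma_mem_iff[OF g(1) hy] by auto
      hence "?F x' \<otimes> \<sigma> x' (h y') \<in> I"
        using I.I_r_closed I.I_l_closed sigma_closed[OF g(1) hy] CS_carrierD(1)[OF F] by blast
      thus ?thesis using I.I_r_closed c_closed[OF g] by blast
    qed
    from CS_mult_coeff_unique[OF I.is_ideal F h(1) xyG this]
    obtain j where j: "j \<in> I" "(?F \<otimes>\<^bsub>CS\<^esub> h) (x \<otimes>\<^bsub>G\<^esub> y) = ?F x \<otimes> \<sigma> x (h y) \<otimes> c x y \<oplus> j"
      by blast
    have "(?F \<otimes>\<^bsub>CS\<^esub> h) (x \<otimes>\<^bsub>G\<^esub> y) \<in> I"
      using annihilatingD(5)[OF a m] unfolding coeff_ideal_def by blast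
    hence "?F x \<otimes> \<sigma> x (h y) \<otimes> c x y \<in> I"
      using I.add_mem_iff[OF term_closed[OF F h(1) xyG] j(1)] j(2) by simp
    moreover have "?F x \<otimes> \<sigma> x (h y) \<in> carrier R"
      using CS_carrierD(1)[OF F] CS_carrierD(1)[OF h(1)] xyG by (simp add: sigma_closed)
    ultimately have "?F x \<otimes> \<sigma> x (h y) \<in> I"
      using I.mult_Unit_right_mem_iff[OF _ c_unit[OF xyG]] by blast
    thus ?thesis using CS_mult_monom_one_right[OF f(1) s xyG(1)] by simp
  qed
  thus thesis using that xy by blast
qed

text \<open>Minimality is used twice, first to shrink \<open>f\<close> from the right and then to
  shrink \<open>h\<close> from the left. The first reduction only produces middle factors
  \<open>\<sigma> x s\<close>; \<open>absorb\<close> replaces them by the arbitrary \<open>r\<close>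
  of the second.\<close>

lemma minimal_annihilating_coeff:
  assumes min: "minimal_annihilating f h"
    and absorb: "\<And>x a b r. x \<in> carrier G \<Longrightarrow> a \<in> carrier R \<Longrightarrow> b \<in> carrier R \<Longrightarrow> r \<in> carrier R \<Longrightarrow>
      (\<And>s. s \<in> carrier R \<Longrightarrow> a \<otimes> \<sigma> x s \<otimes> b \<in> I) \<Longrightarrow> a \<otimes> r \<otimes> b \<in> I"
    and xG: "x \<in> carrier G" and yG: "y \<in> carrier G" and r: "r \<in> carrier R"
  shows "f x \<otimes> r \<otimes> \<sigma> x (h y) \<in> I"
proof -
  have a: "annihilating f h" by (rule minimal_annihilatingD(1)[OF min])
  note f = annihilatingD(1)[OF a] and h = annihilatingD(3)[OF a]
  note fc = CS_carrierD(1)[OF f] and hc = CS_carrierD(1)[OF h]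
  obtain x0 y0 where x0: "x0 \<in> isupp f" and y0: "y0 \<in> isupp h"
    and u: "\<And>s. s \<in> carrier R \<Longrightarrow> f x0 \<otimes> \<sigma> x0 s \<otimes> \<sigma> x0 (h y0) \<in> I"
    using annihilating_unique_product[OF a] by blast
  have "f x \<otimes> \<sigma> x s \<otimes> \<sigma> x (h y0) \<in> I" if s: "s \<in> carrier R" for s
  proof -
    let ?m = "crossed_monom R \<one>\<^bsub>G\<^esub> (s \<otimes> h y0)"
    have m: "?m \<in> carrier CS" using s hc by (simp add: crossed_monom_closed)
    have coeff: "(f \<otimes>\<^bsub>CS\<^esub> ?m) z = f z \<otimes> \<sigma> z s \<otimes> \<sigma> z (h y0)" if z: "z \<in> carrier G" for z
      using CS_mult_monom_one_right[OF f _ z, of "s \<otimes> h y0"] s hc fc z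
      by (simp add: sigma_mult sigma_closed m_assoc)
    have "f \<otimes>\<^bsub>CS\<^esub> ?m \<in> coeff_ideal I"
    proof (rule ccontr)
      assume n: "f \<otimes>\<^bsub>CS\<^esub> ?m \<notin> coeff_ideal I"
      \<comment> \<open>Each new coefficient is a right multiple of the old one, so no index is
        gained, while \<open>u\<close> removes \<open>x0\<close>.\<close>
      have "isupp (f \<otimes>\<^bsub>CS\<^esub> ?m) \<subseteq> isupp f - {x0}"
      proof
        fix z assume z: "z \<in> isupp (f \<otimes>\<^bsub>CS\<^esub> ?m)"
        hence zG: "z \<in> carrier G" using isupp_subset_carrier CS_mult_closed[OF f m] by blast
        have "f z \<otimes> \<sigma> z s \<otimes> \<sigma> z (h y0) \<notin> I" using z coeff[OF zG] by (simp add: isupp_def)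
        thus "z \<in> isupp f - {x0}"
          using u[OF s] I.I_r_closed sigma_closed[OF zG] s hc by (auto simp: isupp_def)
      qed
      hence "isupp (f \<otimes>\<^bsub>CS\<^esub> ?m) \<subset> isupp f" using x0 by blast
      hence "card (isupp (f \<otimes>\<^bsub>CS\<^esub> ?m)) < card (isupp f)"
        using finite_isupp[OF f] by (rule psubset_card_mono[rotated])
      thus False using minimal_annihilatingD(2)[OF min annihilating_mult_right[OF a m n]]
        by (simp add: weight_def)
    qed
    hence "(f \<otimes>\<^bsub>CS\<^esub> ?m) x \<in> I" unfolding coeff_ideal_def by blast
    thus ?thesis using coeff[OF xG] by simp
  qed
  hence vanish: "f x \<otimes> r \<otimes> \<sigma> x (h y0) \<in> I"
    by (rule absorb[OF xG fc sigma_closed[OF xG hc] r])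
  \<comment> \<open>With this coefficient, \<open>vanish\<close> says that multiplication by the
    monomial loses the index \<open>y0\<close> of \<open>h\<close>.\<close>
  let ?m = "crossed_monom R x (f x \<otimes> r)"
  have fr: "f x \<otimes> r \<in> carrier R" using fc r by simp
  have m: "?m \<in> carrier CS" using xG fr by (simp add: crossed_monom_closed)
  have "?m \<otimes>\<^bsub>CS\<^esub> h \<in> coeff_ideal I"
  proof (rule ccontr)
    assume n: "?m \<otimes>\<^bsub>CS\<^esub> h \<notin> coeff_ideal I"
    have "{y \<in> isupp h. f x \<otimes> r \<otimes> \<sigma> x (h y) \<notin> I} \<subset> isupp h" using vanish y0 by blast
    hence "card {y \<in> isupp h. f x \<otimes> r \<otimes> \<sigma> x (h y) \<notin> I} < card (isupp h)"
      using finite_isupp[OF h] by (rule psubset_card_mono[rotated])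
    hence "card (isupp (?m \<otimes>\<^bsub>CS\<^esub> h)) < card (isupp h)"
      using card_isupp_monom_mult[OF xG fr h] by linarith
    thus False using minimal_annihilatingD(2)[OF min annihilating_mult_left[OF a m n]]
      by (simp add: weight_def)
  qed
  hence "(?m \<otimes>\<^bsub>CS\<^esub> h) (x \<otimes>\<^bsub>G\<^esub> y) \<in> I" unfolding coeff_ideal_def by blast
  thus ?thesis
    using monom_mult_coeff[OF xG yG fr h] I.mult_Unit_right_mem_iff[OF _ c_unit[OF xG yG]]
      fr hc sigma_closed[OF xG] by simp
qed

text \<open>Invariance keeps a coefficient outside \<open>I\<close>, and the support bound keeps the
  weight from growing. The new pair brings the twisted coefficients \<open>\<sigma> t (h y)\<close>
  into play.\<close>

lemma minimal_annihilating_monom_mult: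
  assumes min: "minimal_annihilating f h" and t: "t \<in> carrier G"
  shows "minimal_annihilating f (crossed_monom R t \<one> \<otimes>\<^bsub>CS\<^esub> h)"
proof -
  let ?m = "crossed_monom R t \<one>"
  have a: "annihilating f h" by (rule minimal_annihilatingD(1)[OF min])
  note h = annihilatingD(3,4)[OF a]
  have m: "?m \<in> carrier CS" using t by (simp add: crossed_monom_closed)
  obtain y where y: "h y \<notin> I" "y \<in> carrier G"
    using isupp_nonempty[OF h(2)] isupp_subset_carrier[OF h(1)] by (auto simp: isupp_def)
  have hy: "h y \<in> carrier R" by (rule CS_carrierD(1)[OF h(1)])
  have "(?m \<otimes>\<^bsub>CS\<^esub> h) (t \<otimes>\<^bsub>G\<^esub> y) \<notin> I"
    using monom_mult_coeff[OF t y(2) one_closed h(1)] sigma_mem_iff[OF t hy] y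
      I.mult_Unit_right_mem_iff[OF sigma_closed[OF t hy] c_unit[OF t y(2)]] sigma_closed[OF t hy]
    by simp
  hence "?m \<otimes>\<^bsub>CS\<^esub> h \<notin> coeff_ideal I" by (auto simp: coeff_ideal_def)
  hence "annihilating f (?m \<otimes>\<^bsub>CS\<^esub> h)" by (rule annihilating_mult_left[OF a m])
  moreover have "card (isupp (?m \<otimes>\<^bsub>CS\<^esub> h)) \<le> card (isupp h)"
    by (rule order_trans[OF card_isupp_monom_mult[OF t one_closed h(1)]])
      (rule card_mono[OF finite_isupp[OF h(1)]], blast)
  hence "weight f (?m \<otimes>\<^bsub>CS\<^esub> h) \<le> weight f h" by (simp add: weight_def)
  ultimately show ?thesis
    using minimal_annihilatingD(2)[OF min] order_trans unfolding minimal_annihilating_def by blast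
qed

section \<open>The condition on ideals of \<open>R\<close> implies primeness of the
  extension\<close>

text \<open>The hypotheses \<open>absorb\<close> and \<open>untwist\<close> are what the cases (a) and (b) have in common.\<close>

lemma coeff_ideal_prime:
  assumes proper: "I \<noteq> carrier R"
    and G_prime: "\<And>A B. ideal A R \<Longrightarrow> ideal B R \<Longrightarrow> G_stable G \<sigma> B \<Longrightarrow> A \<cdot> B \<subseteq> I \<Longrightarrow> A \<subseteq> I \<or> B \<subseteq> I"
    and absorb: "\<And>x a b r. x \<in> carrier G \<Longrightarrow> a \<in> carrier R \<Longrightarrow> b \<in> carrier R \<Longrightarrow> r \<in> carrier R \<Longrightarrow>
      (\<And>s. s \<in> carrier R \<Longrightarrow> a \<otimes> \<sigma> x s \<otimes> b \<in> I) \<Longrightarrow> a \<otimes> r \<otimes> b \<in> I"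
    and untwist: "\<And>x a b. x \<in> carrier G \<Longrightarrow> a \<in> carrier R - I \<Longrightarrow> b \<in> carrier R - I \<Longrightarrow>
      (\<And>t r. t \<in> carrier G \<Longrightarrow> r \<in> carrier R \<Longrightarrow> a \<otimes> r \<otimes> \<sigma> x (\<sigma> t b) \<in> I) \<Longrightarrow>
      \<exists>a'\<in>carrier R - I. \<exists>b'\<in>carrier R - I. \<forall>t\<in>carrier G. \<forall>r\<in>carrier R. a' \<otimes> r \<otimes> \<sigma> t b' \<in> I"
  shows "noncomm_primeideal (coeff_ideal I) CS"
proof -
  interpret CS: ring CS by (rule crossed_product_ring)
  interpret IS: ideal "coeff_ideal I" CS by (rule coeff_ideal_is_ideal[OF I.is_ideal stable])
  have no: False if "annihilating f0 h0" for f0 h0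
  proof -
    have "\<exists>p. annihilating (fst p) (snd p) \<and>
        (\<forall>q. annihilating (fst q) (snd q) \<longrightarrow> weight (fst p) (snd p) \<le> weight (fst q) (snd q))"
      by (rule ex_has_least_nat[of _ "(f0, h0)" "\<lambda>p. weight (fst p) (snd p)"]) (use that in simp)
    then obtain f h where min: "minimal_annihilating f h"
      unfolding minimal_annihilating_def by auto
    note a = minimal_annihilatingD(1)[OF min]
    note f = annihilatingD(1,2)[OF a] and h = annihilatingD(3,4)[OF a]
    obtain x y where x: "f x \<notin> I" "x \<in> carrier G" and y: "h y \<notin> I" "y \<in> carrier G"
      using isupp_nonempty[OF f(2)] isupp_subset_carrier[OF f(1)]
        isupp_nonempty[OF h(2)] isupp_subset_carrier[OF h(1)] by (auto simp: isupp_def)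
    have fx: "f x \<in> carrier R" and hy: "h y \<in> carrier R" using f h CS_carrierD(1) by blast+
    have "f x \<otimes> r \<otimes> \<sigma> x (\<sigma> t (h y)) \<in> I" if t: "t \<in> carrier G" and r: "r \<in> carrier R" for t r
    proof -
      note ty = c_unit[OF t y(2)]
      have ty': "c t y \<in> carrier R" "inv c t y \<in> carrier R" using ty by auto
      have thy: "\<sigma> t (h y) \<in> carrier R" using t hy by (rule sigma_closed)
      have "f x \<otimes> r \<otimes> \<sigma> x ((crossed_monom R t \<one> \<otimes>\<^bsub>CS\<^esub> h) (t \<otimes>\<^bsub>G\<^esub> y)) \<in> I"
        by (rule minimal_annihilating_coeff[OF minimal_annihilating_monom_mult[OF min t] absorb])
          (use x y t r in auto)
      hence "f x \<otimes> r \<otimes> \<sigma> x (\<sigma> t (h y) \<otimes> c t y) \<in> I"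
        using monom_mult_coeff[OF t y(2) one_closed h(1)] thy by simp
      \<comment> \<open>The unit \<open>c t y\<close> sits inside \<open>\<sigma> x\<close>, so it
        is cancelled by the image of its inverse.\<close>
      hence "f x \<otimes> r \<otimes> \<sigma> x (\<sigma> t (h y) \<otimes> c t y) \<otimes> \<sigma> x (inv c t y) \<in> I"
        using sigma_closed[OF x(2) ty'(2)] by (rule I.I_r_closed)
      moreover have "f x \<otimes> r \<otimes> \<sigma> x (\<sigma> t (h y) \<otimes> c t y) \<otimes> \<sigma> x (inv c t y)
          = f x \<otimes> r \<otimes> \<sigma> x ((\<sigma> t (h y) \<otimes> c t y) \<otimes> inv c t y)"
        using sigma_mult[OF x(2), of "\<sigma> t (h y) \<otimes> c t y" "inv c t y"] thy ty' fx r sigma_closed[OF x(2)]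
        by (simp add: m_assoc)
      moreover have "(\<sigma> t (h y) \<otimes> c t y) \<otimes> inv c t y = \<sigma> t (h y)"
        using thy ty' ty by (simp add: m_assoc)
      ultimately show ?thesis by simp
    qed
    then obtain a b where a: "a \<in> carrier R" "a \<notin> I" and b: "b \<in> carrier R" "b \<notin> I"
      and ab: "\<And>t r. t \<in> carrier G \<Longrightarrow> r \<in> carrier R \<Longrightarrow> a \<otimes> r \<otimes> \<sigma> t b \<in> I"
      using untwist[of x "f x" "h y"] x y fx hy by blast
    \<comment> \<open>Quantifying over \<open>r\<close> gives closure under left multiplication, and
      quantifying over \<open>t\<close> aims at stability. \<open>A\<close> consists of the left
      multipliers of \<open>B\<close> into \<open>I\<close>; it contains \<open>a\<close> by the
      choice of the identities for \<open>t\<close> and \<open>r\<close>.\<close>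
    define B where "B = {b \<in> carrier R. \<forall>t\<in>carrier G. \<forall>r\<in>carrier R. a \<otimes> r \<otimes> \<sigma> t b \<in> I}"
    define A where "A = {a \<in> carrier R. \<forall>b\<in>B. a \<otimes> b \<in> I}"
    have Bc: "b \<in> B \<Longrightarrow> b \<in> carrier R" for b by (simp add: B_def)
    have B: "ideal B R"
    proof (rule idealI_closed)
      show "B \<subseteq> carrier R" by (auto simp: B_def)
      show "\<zero> \<in> B" using a by (auto simp: B_def sigma_zero)
      fix b b' assume b: "b \<in> B"
      show "b \<oplus> b' \<in> B" if "b' \<in> B"
        using b that a by (auto simp: B_def sigma_add sigma_closed r_distr)
      assume s: "b' \<in> carrier R"
      note bc = Bc[OF b]
      have "a \<otimes> r \<otimes> \<sigma> t (b' \<otimes> b) \<in> I" "a \<otimes> r \<otimes> \<sigma> t (b \<otimes> b') \<in> I"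
        if t: "t \<in> carrier G" and r: "r \<in> carrier R" for t r
      proof -
        note sc = sigma_closed[OF t s] sigma_closed[OF t bc]
        have "a \<otimes> (r \<otimes> \<sigma> t b') \<otimes> \<sigma> t b \<in> I" using b t r sc by (simp add: B_def)
        thus "a \<otimes> r \<otimes> \<sigma> t (b' \<otimes> b) \<in> I"
          using a t r s bc sc by (simp add: sigma_mult m_assoc)
        have "a \<otimes> r \<otimes> \<sigma> t b \<otimes> \<sigma> t b' \<in> I" using b t r sc by (auto simp: B_def intro: I.I_r_closed)
        thus "a \<otimes> r \<otimes> \<sigma> t (b \<otimes> b') \<in> I"
          using a t r s bc sc by (simp add: sigma_mult m_assoc)
      qed
      thus "b' \<otimes> b \<in> B" "b \<otimes> b' \<in> B" using s bc by (auto simp: B_def)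
    qed
    have stB: "G_stable G \<sigma> B"
      unfolding G_stable_def
    proof (intro ballI subsetI)
      fix g v assume g: "g \<in> carrier G" and "v \<in> \<sigma> g ` B"
      then obtain b where b: "b \<in> B" "v = \<sigma> g b" by blast
      note bc = Bc[OF b(1)]
      have "a \<otimes> r \<otimes> \<sigma> t (\<sigma> g b) \<in> I" if t: "t \<in> carrier G" and r: "r \<in> carrier R" for t r
      proof -
        have tg: "t \<otimes>\<^bsub>G\<^esub> g \<in> carrier G" "c t g \<in> carrier R" using t g c_closed by auto
        \<comment> \<open>The free scalar is taken to be \<open>r \<otimes> c t g\<close>, so that
          \<open>twist\<close> can move the unit to the right end, where it drops out.\<close>
        have "a \<otimes> (r \<otimes> c t g) \<otimes> \<sigma> (t \<otimes>\<^bsub>G\<^esub> g) b \<in> I" using b r tg by (simp add: B_def)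
        moreover have "a \<otimes> (r \<otimes> c t g) \<otimes> \<sigma> (t \<otimes>\<^bsub>G\<^esub> g) b = a \<otimes> r \<otimes> (c t g \<otimes> \<sigma> (t \<otimes>\<^bsub>G\<^esub> g) b)"
          using a r tg sigma_closed[OF tg(1) bc] by (simp add: m_assoc)
        moreover have "\<dots> = a \<otimes> r \<otimes> \<sigma> t (\<sigma> g b) \<otimes> c t g"
          using twist[OF t g bc] a r tg t g bc by (simp add: m_assoc sigma_closed)
        ultimately have "a \<otimes> r \<otimes> \<sigma> t (\<sigma> g b) \<otimes> c t g \<in> I" by simp
        thus ?thesis using I.mult_Unit_right_mem_iff[OF _ c_unit[OF t g]] a r t g bc sigma_closed by simp
      qed
      thus "v \<in> B" using b(2) g bc by (simp add: B_def sigma_closed)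
    qed
    interpret B: ideal B R by (rule B)
    have A: "ideal A R"
    proof (rule idealI_closed)
      show "A \<subseteq> carrier R" by (auto simp: A_def)
      show "\<zero> \<in> A" using Bc by (simp add: A_def)
      fix d e assume d: "d \<in> A"
      hence dc: "d \<in> carrier R" by (simp add: A_def)
      show "d \<oplus> e \<in> A" if "e \<in> A" using d that Bc by (auto simp: A_def l_distr)
      assume e: "e \<in> carrier R"
      show "e \<otimes> d \<in> A" using d dc e Bc I.I_l_closed by (simp add: A_def m_assoc)
      show "d \<otimes> e \<in> A" using d dc e Bc B.I_l_closed by (simp add: A_def m_assoc)
    qed
    have "A \<cdot> B \<subseteq> I"
    proof
      fix v assume "v \<in> A \<cdot> B"
      thus "v \<in> I" by induction (auto simp: A_def)
    qed
    hence "A \<subseteq> I \<or> B \<subseteq> I" by (rule G_prime[OF A B stB])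
    moreover have "b \<in> B" using b ab unfolding B_def by blast
    moreover have "a \<in> A"
    proof -
      have "a \<otimes> d \<in> I" if d: "d \<in> B" for d
      proof -
        have "a \<otimes> \<one> \<otimes> \<sigma> \<one>\<^bsub>G\<^esub> d \<in> I" using d G.one_closed one_closed unfolding B_def by blast
        thus ?thesis using a sigma_one[OF Bc[OF d]] by simp
      qed
      thus ?thesis using a unfolding A_def by blast
    qed
    ultimately show False using a b by blast
  qed
  show ?thesis
  proof unfold_locales
    have "\<one> \<notin> I" using proper I.one_imp_carrier by blast
    hence "\<one>\<^bsub>CS\<^esub> \<one>\<^bsub>G\<^esub> \<notin> I" by (simp add: CS_one crossed_monom_def)
    hence "\<one>\<^bsub>CS\<^esub> \<notin> coeff_ideal I" unfolding coeff_ideal_def by blast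
    thus "coeff_ideal I \<noteq> carrier CS" using CS.one_closed by blast
  next
    fix A B assume A: "ideal A CS" and B: "ideal B CS" and AB: "A \<cdot>\<^bsub>CS\<^esub> B \<subseteq> coeff_ideal I"
    show "A \<subseteq> coeff_ideal I \<or> B \<subseteq> coeff_ideal I"
    proof (rule ccontr)
      assume "\<not> ?thesis"
      then obtain f h where f: "f \<in> A" "f \<notin> coeff_ideal I" and h: "h \<in> B" "h \<notin> coeff_ideal I" by blast
      \<comment> \<open>The ideal \<open>A\<close> absorbs \<open>s\<close>, so a failure of
        primeness for ideals gives an annihilating pair of elements.\<close>
      have "f \<otimes>\<^bsub>CS\<^esub> s \<otimes>\<^bsub>CS\<^esub> h \<in> coeff_ideal I" if "s \<in> carrier CS" for s
        using AB ideal_prod.prod[OF ideal.I_r_closed[OF A f(1) that] h(1)] by blast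
      hence "annihilating f h"
        using f h ideal.Icarr[OF A] ideal.Icarr[OF B] unfolding annihilating_def by blast
      thus False by (rule no)
    qed
  qed
qed

section \<open>The surjective and the commutative case\<close>

lemma absorb_of_surjective:
  assumes "pointwise_surjective R G \<sigma>" "x \<in> carrier G" "r \<in> carrier R"
    and "\<And>s. s \<in> carrier R \<Longrightarrow> a \<otimes> \<sigma> x s \<otimes> b \<in> I"
  shows "a \<otimes> r \<otimes> b \<in> I"
proof -
  obtain s where "s \<in> carrier R" "r = \<sigma> x s"
    using assms(1-3) unfolding pointwise_surjective_def by blast
  thus ?thesis using assms(4) by blast
qed

text \<open>Pull \<open>a\<close> back along \<open>\<sigma> x\<close> and keep \<open>b\<close>.
  The whole product is then an image under \<open>\<sigma> x\<close>, which invariance allows to be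
  removed.\<close>

lemma untwist_of_surjective:
  assumes surj: "pointwise_surjective R G \<sigma>" and x: "x \<in> carrier G"
    and a: "a \<in> carrier R - I" and b: "b \<in> carrier R - I"
    and ab: "\<And>t r. t \<in> carrier G \<Longrightarrow> r \<in> carrier R \<Longrightarrow> a \<otimes> r \<otimes> \<sigma> x (\<sigma> t b) \<in> I"
  shows "\<exists>a'\<in>carrier R - I. \<exists>b'\<in>carrier R - I. \<forall>t\<in>carrier G. \<forall>r\<in>carrier R. a' \<otimes> r \<otimes> \<sigma> t b' \<in> I"
proof -
  obtain a' where a': "a' \<in> carrier R" "a = \<sigma> x a'"
    using surj x a unfolding pointwise_surjective_def by blast
  have "a' \<notin> I" using a a' sigma_mem_iff[OF x a'(1)] by blast
  moreover have "a' \<otimes> r \<otimes> \<sigma> t b \<in> I" if t: "t \<in> carrier G" and r: "r \<in> carrier R" for t r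
  proof -
    have tb: "\<sigma> t b \<in> carrier R" using t b sigma_closed by blast
    have "\<sigma> x (a' \<otimes> r \<otimes> \<sigma> t b) = a \<otimes> \<sigma> x r \<otimes> \<sigma> x (\<sigma> t b)"
      using a' r tb x by (simp add: sigma_mult)
    thus ?thesis
      using ab[OF t sigma_closed[OF x r]] sigma_mem_iff[OF x, of "a' \<otimes> r \<otimes> \<sigma> t b"] a'(1) r tb
      by simp
  qed
  ultimately show ?thesis using a'(1) b by blast
qed

text \<open>The choice of \<open>\<one>\<close> for \<open>s\<close> already gives
  \<open>a \<otimes> b \<in> I\<close>, and commutativity moves \<open>r\<close> into the
  middle.\<close>

lemma absorb_of_cring:
  assumes "cring R" "x \<in> carrier G" "a \<in> carrier R" "b \<in> carrier R" "r \<in> carrier R"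
    and "\<And>s. s \<in> carrier R \<Longrightarrow> a \<otimes> \<sigma> x s \<otimes> b \<in> I"
  shows "a \<otimes> r \<otimes> b \<in> I"
proof -
  interpret C: cring R by (rule assms)
  have "a \<otimes> b \<in> I" using assms(6)[OF one_closed] assms(2,3) by (simp add: sigma_ring_one)
  hence "r \<otimes> (a \<otimes> b) \<in> I" using assms(5) by (rule I.I_l_closed)
  moreover have "r \<otimes> (a \<otimes> b) = a \<otimes> r \<otimes> b"
    using assms(3-5) by (simp add: C.m_comm C.m_lcomm m_assoc)
  ultimately show ?thesis by simp
qed

text \<open>Keep \<open>a\<close> and replace \<open>b\<close> by \<open>\<sigma> x b\<close>, which
  stays outside \<open>I\<close> by invariance. Reversibility rewrites
  \<open>\<sigma> t (\<sigma> x b)\<close> as \<open>\<sigma> x (\<sigma> t' b)\<close>, where the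
  hypothesis applies.\<close>

lemma untwist_of_cring:
  assumes cr: "cring R" and rev: "reversible_up_to_conjugation R G \<sigma>" and x: "x \<in> carrier G"
    and a: "a \<in> carrier R - I" and b: "b \<in> carrier R - I"
    and ab: "\<And>t r. t \<in> carrier G \<Longrightarrow> r \<in> carrier R \<Longrightarrow> a \<otimes> r \<otimes> \<sigma> x (\<sigma> t b) \<in> I"
  shows "\<exists>a'\<in>carrier R - I. \<exists>b'\<in>carrier R - I. \<forall>t\<in>carrier G. \<forall>r\<in>carrier R. a' \<otimes> r \<otimes> \<sigma> t b' \<in> I"
proof -
  have bc: "b \<in> carrier R" using b by blast
  have xb: "\<sigma> x b \<in> carrier R - I" using b sigma_closed[OF x bc] sigma_mem_iff[OF x bc] by blast
  have "a \<otimes> r \<otimes> \<sigma> t (\<sigma> x b) \<in> I" if t: "t \<in> carrier G" and r: "r \<in> carrier R" for t r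
  proof -
    obtain t' where t': "t' \<in> carrier G" "conj_equiv R \<sigma> (t \<otimes>\<^bsub>G\<^esub> x) (x \<otimes>\<^bsub>G\<^esub> t')"
      using rev x t unfolding reversible_up_to_conjugation_def by blast
    have "\<sigma> t (\<sigma> x b) = \<sigma> (t \<otimes>\<^bsub>G\<^esub> x) b" by (rule sigma_comp_of_cring[OF cr t x bc])
    also have "\<dots> = \<sigma> (x \<otimes>\<^bsub>G\<^esub> t') b"
      by (rule conj_equivD_of_cring[OF cr t'(2) bc]) (use x t'(1) in simp)
    also have "\<dots> = \<sigma> x (\<sigma> t' b)" by (rule sigma_comp_of_cring[OF cr x t'(1) bc, symmetric])
    finally show ?thesis using ab[OF t'(1) r] by simp
  qed
  thus ?thesis using a xb by blast
qed

end

theorem corollary4p6: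
  fixes R :: "('r, 'm) ring_scheme" and G :: "('g, 'n) monoid_scheme"
    and \<sigma> :: "'g \<Rightarrow> 'r \<Rightarrow> 'r" and c :: "'g \<Rightarrow> 'g \<Rightarrow> 'r" and I :: "'r set"
  assumes "unique_product_monoid G"
    and "crossed_system R G \<sigma> c"
    and "ideal I R" and "I \<noteq> carrier R"
    and "G_invariant R G \<sigma> I"
    and "(cring R \<and> reversible_up_to_conjugation R G \<sigma>) \<or> pointwise_surjective R G \<sigma>"
  shows "S_prime R G \<sigma> c I \<longleftrightarrow>
    (\<forall>A B. ideal A R \<longrightarrow> ideal B R \<longrightarrow> G_stable G \<sigma> B \<longrightarrow>
      A \<cdot>\<^bsub>R\<^esub> B \<subseteq> I \<longrightarrow> A \<subseteq> I \<or> B \<subseteq> I)"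
proof -
  interpret invariant_ideal_system R G \<sigma> c I
    using assms(1-3,5) unfolding invariant_ideal_system_def invariant_ideal_system_axioms_def by blast
  have S_prime_iff: "S_prime R G \<sigma> c I \<longleftrightarrow> noncomm_primeideal (coeff_ideal I) CS"
    unfolding S_prime_def ideal_extension_eq_coeff_ideal[OF assms(3)] ..
  show ?thesis
  proof
    assume "S_prime R G \<sigma> c I"
    thus "\<forall>A B. ideal A R \<longrightarrow> ideal B R \<longrightarrow> G_stable G \<sigma> B \<longrightarrow>
        A \<cdot>\<^bsub>R\<^esub> B \<subseteq> I \<longrightarrow> A \<subseteq> I \<or> B \<subseteq> I"
      unfolding S_prime_iff using ideal_prod_subset_if_coeff_ideal_prime[OF assms(3) stable] by blast
  next
    assume G_prime: "\<forall>A B. ideal A R \<longrightarrow> ideal B R \<longrightarrow> G_stable G \<sigma> B \<longrightarrow>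
        A \<cdot>\<^bsub>R\<^esub> B \<subseteq> I \<longrightarrow> A \<subseteq> I \<or> B \<subseteq> I"
    show "S_prime R G \<sigma> c I"
      unfolding S_prime_iff
    proof (rule coeff_ideal_prime[OF assms(4)])
      show "A \<subseteq> I \<or> B \<subseteq> I"
        if "ideal A R" "ideal B R" "G_stable G \<sigma> B" "A \<cdot>\<^bsub>R\<^esub> B \<subseteq> I" for A B
        using G_prime that by blast
    next
      fix x a b r assume *: "x \<in> carrier G" "a \<in> carrier R" "b \<in> carrier R" "r \<in> carrier R"
        "\<And>s. s \<in> carrier R \<Longrightarrow> a \<otimes>\<^bsub>R\<^esub> \<sigma> x s \<otimes>\<^bsub>R\<^esub> b \<in> I"
      show "a \<otimes>\<^bsub>R\<^esub> r \<otimes>\<^bsub>R\<^esub> b \<in> I"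
        using assms(6) absorb_of_cring[OF _ *] absorb_of_surjective[OF _ *(1,4,5)] by blast
    next
      fix x a b assume *: "x \<in> carrier G" "a \<in> carrier R - I" "b \<in> carrier R - I"
        "\<And>t r. t \<in> carrier G \<Longrightarrow> r \<in> carrier R \<Longrightarrow> a \<otimes>\<^bsub>R\<^esub> r \<otimes>\<^bsub>R\<^esub> \<sigma> x (\<sigma> t b) \<in> I"
      show "\<exists>a'\<in>carrier R - I. \<exists>b'\<in>carrier R - I. \<forall>t\<in>carrier G. \<forall>r\<in>carrier R.
          a' \<otimes>\<^bsub>R\<^esub> r \<otimes>\<^bsub>R\<^esub> \<sigma> t b' \<in> I"
        using assms(6) untwist_of_cring[OF _ _ *] untwist_of_surjective[OF _ *] by blast
    qed
  qed
qed

end
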